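(* Let $l,u$ be integers with $0\le l\le u\le K$, $u>0$, $l<K$. Suppose that for every $\alpha,\beta\in(0,1)$ the thresholds $a,b,c,d$ of the synchronous procedure $\check\chi$ are chosen so that $\check\chi\in\Delta(\alpha,\beta,\Pi_{l,u})$, and that $a,c\sim|\log\alpha|$, $b,d\sim|\log\beta|$ as $\alpha,\beta\to0$. Suppose that for every $k\in[K]$ there are positive $I_k,J_k$ such that $\mathrm P_k^1(\limsup_n\lambda_k(n)/n\le I_k)=1$, $\mathrm P_k^0(\limsup_n(-\lambda_k(n))/n\le J_k)=1$, and for every $\epsilon>0$, $\sum_n\mathrm P_k^1(\lambda_k(n)/n\le I_k-\epsilon)<\infty$, $\sum_n\mathrm P_k^0(-\lambda_k(n)/n\le J_k-\epsilon)<\infty$. Then, as $\alpha,\beta\to0$, $$\mathrm E_A[\check T]\sim\mathcal L''_A(\alpha,\beta,\Pi_{l,u})\sim\max\Big\{\frac{|\log\alpha|}{\mathcal I_A+\mathcal J_A\mathbf 1\{|A|=l\}},\ \frac{|\log\beta|}{\mathcal J_A+\mathcal I_A\mathbf 1\{|A|=u\}}\Big\}$$ simultaneously for every $A\in\Pi_{l,u}$.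
   Context: Let $K\ge1$, $[K]=\{1,\dots,K\}$, $\mathbb N=\{1,2,\dots\}$. There are $K$ independent data streams $X_k=\{X_k(n):n\in\mathbb N\}$; $\mathcal F_k(n)=\sigma(X_k(t):t\le n)$, $\mathcal F(n)=\sigma(\mathcal F_k(n):k\in[K])$. For each $k$, $\mathrm P_k^0,\mathrm P_k^1$ are distributions of $X_k$ mutually absolutely continuous on each $\mathcal F_k(n)$, $\lambda_k(n)=\log\frac{d\mathrm P_k^1}{d\mathrm P_k^0}(\mathcal F_k(n))$. For $A\subseteq[K]$, $\mathrm P_A$ is the joint law with independent streams, $X_k\sim\mathrm P_k^1$ if $k\in A$, $\mathrm P_k^0$ otherwise; $\mathrm E_A$ its expectation. $\mathcal I_A=\min_{i\in A}I_i$, $\mathcal J_A=\min_{j\notin A}J_j$. $\Pi_{l,u}=\{A\subseteq[K]:l\le|A|\le u\}$. $\lambda_{(1)}(n)\ge\dots\ge\lambda_{(K)}(n)$ are the ordered LLRs, $p(n)=|\{k:\lambda_k(n)>0\}|$, with $\lambda_{(0)}\equiv+\infty$, $\lambda_{(K+1)}\equiv-\infty$ when needed. A procedure $\chi=(\mathbf T,\mathbf D)$: $\mathbb N$-valued stopping times $T_k$ w.r.t. $\{\mathcal F(n)\}$ and $\mathcal F(T_k)$-measurable Bernoulli $D_k$; synchronous if $T_1=\dots=T_K$ (class $\Delta''$). $\mathrm{FWE}^1_A(\chi)=\mathrm P_A(\exists j\notin A:D_j=1)$, $\mathrm{FWE}^2_A(\chi)=\mathrm P_A(\exists i\in A:D_i=0)$.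 $\Delta(\alpha,\beta,\Pi)$: procedures with $\mathrm{FWE}^1_A\le\alpha$, $\mathrm{FWE}^2_A\le\beta$ for all $A\in\Pi$. $\mathcal L''_A(\alpha,\beta,\Pi)=\inf\{\mathrm E_A[T_1]:\chi\in\Delta''\cap\Delta(\alpha,\beta,\Pi)\}$. Synchronous procedure $\check\chi$ (thresholds $a,b,c,d>0$), common decision time $\check T$: if $l=u\equiv m$, $\check T=\inf\{n:\lambda_{(m)}(n)-\lambda_{(m+1)}(n)\ge c\vee d\}$ and the $m$ streams with largest LLRs at $\check T$ are declared signals; if $l<u$, $\check T=\tau_1\wedge\tau_2\wedge\tau_3$ with $\tau_1=\inf\{n:\lambda_{(l+1)}(n)\le\min\{-b,-c+\lambda_{(l)}(n)\}\}$, $\tau_2=\inf\{n:\lambda_k(n)\notin(-b,a)\ \forall k,\ l\le p(n)\le u\}$, $\tau_3=\inf\{n:\lambda_{(u)}(n)\ge\max\{a,d+\lambda_{(u+1)}(n)\}\}$, and the $(p(\check T)\vee l)\wedge u$ streams with the largest LLRs at $\check T$ are declared signals. $x\sim y$ means $x/y\to1$. *)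

theory Defs
  imports "HOL-Probability.Probability"
begin

text \<open>Observation space N; a single stream is a sequence x :: nat => 'a, where the
  coordinate x t (t = 0,1,...) is the observation X(t+1) of the paper.\<close>

definition seq_space :: "'a measure \<Rightarrow> (nat \<Rightarrow> 'a) measure" where
  "seq_space N = PiM UNIV (\<lambda>_. N)"

definition fin_space :: "'a measure \<Rightarrow> nat \<Rightarrow> (nat \<Rightarrow> 'a) measure" where
  "fin_space N n = PiM {..<n} (\<lambda>_. N)"

definition trunc :: "nat \<Rightarrow> (nat \<Rightarrow> 'a) \<Rightarrow> (nat \<Rightarrow> 'a)" where
  "trunc n x = restrict x {..<n}"

text \<open>restriction of a stream law to F_k(n), realised as the law of the first n observations\<close>
definition marg :: "'a measure \<Rightarrow> (nat \<Rightarrow> 'a) measure \<Rightarrow> nat \<Rightarrow> (nat \<Rightarrow> 'a) measure" where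
  "marg N P n = distr P (fin_space N n) (trunc n)"

definition LLR :: "'a measure \<Rightarrow> (nat \<Rightarrow> 'a) measure \<Rightarrow> (nat \<Rightarrow> 'a) measure \<Rightarrow> nat \<Rightarrow> (nat \<Rightarrow> 'a) \<Rightarrow> real" where
  "LLR N Q0 Q1 n x = ln (enn2real (RN_deriv (marg N Q0 n) (marg N Q1 n) (trunc n x)))"

definition joint_space :: "nat \<Rightarrow> 'a measure \<Rightarrow> (nat \<Rightarrow> nat \<Rightarrow> 'a) measure" where
  "joint_space K N = PiM {..<K} (\<lambda>_. seq_space N)"

definition joint_law :: "nat \<Rightarrow> (nat \<Rightarrow> (nat \<Rightarrow> 'a) measure) \<Rightarrow> (nat \<Rightarrow> (nat \<Rightarrow> 'a) measure)
    \<Rightarrow> nat set \<Rightarrow> (nat \<Rightarrow> nat \<Rightarrow> 'a) measure" where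
  "joint_law K P0 P1 A = PiM {..<K} (\<lambda>k. if k \<in> A then P1 k else P0 k)"

definition obs_filt :: "nat \<Rightarrow> 'a measure \<Rightarrow> nat \<Rightarrow> (nat \<Rightarrow> nat \<Rightarrow> 'a) measure" where
  "obs_filt K N n = vimage_algebra (space (joint_space K N))
     (\<lambda>\<omega>. \<lambda>k\<in>{..<K}. trunc n (\<omega> k)) (PiM {..<K} (\<lambda>_. fin_space N n))"

definition jLLR :: "'a measure \<Rightarrow> (nat \<Rightarrow> (nat \<Rightarrow> 'a) measure) \<Rightarrow> (nat \<Rightarrow> (nat \<Rightarrow> 'a) measure)
    \<Rightarrow> nat \<Rightarrow> nat \<Rightarrow> (nat \<Rightarrow> nat \<Rightarrow> 'a) \<Rightarrow> real" where
  "jLLR N P0 P1 k n \<omega> = LLR N (P0 k) (P1 k) n (\<omega> k)"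

definition ord_stat :: "nat \<Rightarrow> (nat \<Rightarrow> real) \<Rightarrow> nat \<Rightarrow> ereal" where
  "ord_stat K v i = (if i = 0 then \<infinity> else if K < i then -\<infinity>
      else ereal (rev (sort (map v [0..<K])) ! (i - 1)))"

definition pos_count :: "nat \<Rightarrow> (nat \<Rightarrow> real) \<Rightarrow> nat" where
  "pos_count K v = card {k. k < K \<and> 0 < v k}"

definition stop_cond :: "nat \<Rightarrow> nat \<Rightarrow> nat \<Rightarrow> real \<Rightarrow> real \<Rightarrow> real \<Rightarrow> real \<Rightarrow> (nat \<Rightarrow> real) \<Rightarrow> bool" where
  "stop_cond K l u a b c d v =
    (if l = u then ord_stat K v l - ord_stat K v (l + 1) \<ge> ereal (max c d)
     else (ord_stat K v (l + 1) \<le> min (ereal (- b)) (ereal (- c) + ord_stat K v l))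
        \<or> ((\<forall>k<K. v k \<notin> {- b<..<a}) \<and> l \<le> pos_count K v \<and> pos_count K v \<le> u)
        \<or> (ord_stat K v u \<ge> max (ereal a) (ereal d + ord_stat K v (u + 1))))"

definition check_T :: "nat \<Rightarrow> nat \<Rightarrow> nat \<Rightarrow> real \<Rightarrow> real \<Rightarrow> real \<Rightarrow> real \<Rightarrow> (nat \<Rightarrow> nat \<Rightarrow> real) \<Rightarrow> enat" where
  "check_T K l u a b c d lam =
    (if \<exists>n\<ge>1. stop_cond K l u a b c d (\<lambda>k. lam k n)
     then enat (LEAST n. n \<ge> 1 \<and> stop_cond K l u a b c d (\<lambda>k. lam k n)) else \<infinity>)"

definition n_declared :: "nat \<Rightarrow> nat \<Rightarrow> nat \<Rightarrow> (nat \<Rightarrow> real) \<Rightarrow> nat" where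
  "n_declared K l u v = (if l = u then l else min u (max (pos_count K v) l))"

text \<open>stream k is declared a signal iff its LLR is among the n_declared largest
  (there are no ties at the cut when the procedure stops)\<close>
definition check_D :: "nat \<Rightarrow> nat \<Rightarrow> nat \<Rightarrow> real \<Rightarrow> real \<Rightarrow> real \<Rightarrow> real \<Rightarrow> (nat \<Rightarrow> nat \<Rightarrow> real) \<Rightarrow> nat \<Rightarrow> bool" where
  "check_D K l u a b c d lam k =
    (case check_T K l u a b c d lam of
       enat n \<Rightarrow> ord_stat K (\<lambda>j. lam j n) (n_declared K l u (\<lambda>j. lam j n)) \<le> ereal (lam k n)
     | \<infinity> \<Rightarrow> False)"

text \<open>Synchronous procedure (T, D): T a stopping time w.r.t. F(n) with values in {1,2,...}
  (or infinity, ruled out a.s. by in_Delta), D k F(T)-measurable.\<close>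
definition sync_procedure :: "nat \<Rightarrow> 'a measure \<Rightarrow> ((nat \<Rightarrow> nat \<Rightarrow> 'a) \<Rightarrow> enat)
    \<Rightarrow> (nat \<Rightarrow> (nat \<Rightarrow> nat \<Rightarrow> 'a) \<Rightarrow> bool) \<Rightarrow> bool" where
  "sync_procedure K N T D \<longleftrightarrow>
     (\<forall>\<omega>\<in>space (joint_space K N). T \<omega> \<noteq> 0) \<and>
     (\<forall>n. {\<omega>\<in>space (joint_space K N). T \<omega> = enat n} \<in> sets (obs_filt K N n)) \<and>
     (\<forall>k<K. \<forall>n. {\<omega>\<in>space (joint_space K N). T \<omega> = enat n \<and> D k \<omega>} \<in> sets (obs_filt K N n))"

definition Pi_lu :: "nat \<Rightarrow> nat \<Rightarrow> nat \<Rightarrow> nat set set" where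
  "Pi_lu K l u = {A. A \<subseteq> {..<K} \<and> l \<le> card A \<and> card A \<le> u}"

definition in_Delta :: "nat \<Rightarrow> (nat \<Rightarrow> (nat \<Rightarrow> 'a) measure) \<Rightarrow> (nat \<Rightarrow> (nat \<Rightarrow> 'a) measure)
    \<Rightarrow> real \<Rightarrow> real \<Rightarrow> nat set set \<Rightarrow> ((nat \<Rightarrow> nat \<Rightarrow> 'a) \<Rightarrow> enat)
    \<Rightarrow> (nat \<Rightarrow> (nat \<Rightarrow> nat \<Rightarrow> 'a) \<Rightarrow> bool) \<Rightarrow> bool" where
  "in_Delta K P0 P1 \<alpha> \<beta> Hyp T D \<longleftrightarrow>
    (\<forall>A\<in>Hyp.
       emeasure (joint_law K P0 P1 A) {\<omega>\<in>space (joint_law K P0 P1 A). T \<omega> = \<infinity>} = 0 \<and>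
       measure (joint_law K P0 P1 A)
         {\<omega>\<in>space (joint_law K P0 P1 A). T \<omega> \<noteq> \<infinity> \<and> (\<exists>j<K. j \<notin> A \<and> D j \<omega>)} \<le> \<alpha> \<and>
       measure (joint_law K P0 P1 A)
         {\<omega>\<in>space (joint_law K P0 P1 A). T \<omega> \<noteq> \<infinity> \<and> (\<exists>i\<in>A. \<not> D i \<omega>)} \<le> \<beta>)"

definition exp_time :: "nat \<Rightarrow> (nat \<Rightarrow> (nat \<Rightarrow> 'a) measure) \<Rightarrow> (nat \<Rightarrow> (nat \<Rightarrow> 'a) measure)
    \<Rightarrow> nat set \<Rightarrow> ((nat \<Rightarrow> nat \<Rightarrow> 'a) \<Rightarrow> enat) \<Rightarrow> ennreal" where
  "exp_time K P0 P1 A T = (\<integral>\<^sup>+ \<omega>. ennreal_of_enat (T \<omega>) \<partial>joint_law K P0 P1 A)"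

definition L_sync :: "nat \<Rightarrow> 'a measure \<Rightarrow> (nat \<Rightarrow> (nat \<Rightarrow> 'a) measure) \<Rightarrow> (nat \<Rightarrow> (nat \<Rightarrow> 'a) measure)
    \<Rightarrow> real \<Rightarrow> real \<Rightarrow> nat set set \<Rightarrow> nat set \<Rightarrow> ennreal" where
  "L_sync K N P0 P1 \<alpha> \<beta> Hyp A =
     (INF TD \<in> {(T, D). sync_procedure K N T D \<and> in_Delta K P0 P1 \<alpha> \<beta> Hyp T D}.
        exp_time K P0 P1 A (fst TD))"

definition min_over :: "(nat \<Rightarrow> real) \<Rightarrow> nat set \<Rightarrow> ereal" where
  "min_over I A = (if A = {} then \<infinity> else ereal (Min (I ` A)))"

definition opt_rate :: "nat \<Rightarrow> (nat \<Rightarrow> real) \<Rightarrow> (nat \<Rightarrow> real) \<Rightarrow> nat \<Rightarrow> nat \<Rightarrow> nat set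
    \<Rightarrow> real \<Rightarrow> real \<Rightarrow> real" where
  "opt_rate K I J l u A \<alpha> \<beta> = real_of_ereal (max
      (ereal \<bar>ln \<alpha>\<bar> / (min_over I A + (if card A = l then min_over J ({..<K} - A) else 0)))
      (ereal \<bar>ln \<beta>\<bar> / (min_over J ({..<K} - A) + (if card A = u then min_over I A else 0))))"

end

theory Submission
  imports Defs
begin

text \<open>
  Lower bound: given \<open>A\<close>, take \<open>C\<close> in the class differing from \<open>A\<close> in one stream, or, when \<open>|A|\<close>
  is extremal, obtained from \<open>A\<close> by swapping a signal and a noise stream. The error constraints under
  \<open>A\<close> and \<open>C\<close> make some decision event nearly certain under \<open>A\<close> and of probability at most
  \<open>\<epsilon>\<close> under \<open>C\<close>, so by a change of measure the log-likelihood ratio of \<open>A\<close> against \<open>C\<close> must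
  reach about \<open>|log \<epsilon>|\<close> before stopping; its running maximum up to time \<open>h\<close> is at most \<open>(R + o(1)) h\<close>,
  where \<open>R\<close> is the sum of the rates of the streams that were changed.

  Upper bound: at a time \<open>n\<close> exceeding \<open>1 / (1 - \<eta>)\<close> times the optimal rate, the procedure can
  continue only if some log-likelihood ratio is below \<open>(1 - \<eta>) n\<close> times its rate; by complete
  convergence such times contribute only a constant to the expected stopping time.
\<close>

section \<open>Order statistics\<close>

text \<open>The two error levels tend to 0 with no relation between their rates, so each half of the
  maximum needs a lower bound whose size is governed by one level alone. Testing a single stream
  achieves this: the error under A need only be below a fixed constant, while the error under C sets
  the level that the log-likelihood ratio has to reach. At an extremal cardinality removing or
  adding one stream would leave the class; a swap stays inside but is separated at the sum of two
  rates, which is the origin of the indicator terms. Streams with the smallest rates are separated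
  most slowly and give the strongest bound.

  On the other side, stopping is reduced to a deterministic implication between drifts and
  thresholds, \<open>stop_cond_of_drift\<close>, whose margins have as reciprocals exactly the
  weights \<open>w1\<close> and \<open>w2\<close> of the lower bound; hence the two bounds agree to
  first order. The constant left by complete convergence does not depend on the thresholds and is
  absorbed because the rate diverges.\<close>

lemma ord_stat_ge_real_iff:
  assumes "0 < i" "i \<le> K"
  shows "ereal x \<le> ord_stat K v i \<longleftrightarrow> i \<le> card {k. k < K \<and> x \<le> v k}"
proof -
  define xs where "xs = map v [0..<K]"
  define ys where "ys = rev (sort xs)"
  have len: "length ys = K" by (simp add: ys_def xs_def)
  have desc: "ys ! n \<le> ys ! m" if "m \<le> n" "n < K" for m n
    unfolding ys_def by (rule sorted_rev_nth_mono) (use that in \<open>auto simp: xs_def\<close>)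
  \<comment> \<open>Sorting only permutes the values, so the count may be taken in the decreasing
    list \<open>ys\<close>, where the entries that are at least \<open>x\<close> form an initial
    segment.\<close>
  have "card {k. k < K \<and> x \<le> v k} = length (filter ((\<le>) x) xs)"
    by (simp add: length_filter_conv_card xs_def cong: conj_cong)
  also have "\<dots> = size (filter_mset ((\<le>) x) (mset ys))"
    by (simp add: ys_def flip: mset_filter)
  also have "\<dots> = card {m. m < K \<and> x \<le> ys ! m}"
    by (simp add: length_filter_conv_card len flip: mset_filter)
  finally have card: "card {k. k < K \<and> x \<le> v k} = card {m. m < K \<and> x \<le> ys ! m}" .
  have os: "ord_stat K v i = ereal (ys ! (i - 1))"
    using assms by (simp add: ord_stat_def ys_def xs_def)
  show ?thesis
  proof (cases "x \<le> ys ! (i - 1)")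
    case True
    have "{..<i} \<subseteq> {m. m < K \<and> x \<le> ys ! m}"
    proof
      fix m assume "m \<in> {..<i}"
      then show "m \<in> {m. m < K \<and> x \<le> ys ! m}"
        using desc[of m "i - 1"] True assms by (auto intro: order_trans)
    qed
    then have "card {..<i} \<le> card {m. m < K \<and> x \<le> ys ! m}"
      by (intro card_mono) auto
    with True show ?thesis by (simp add: card os)
  next
    case False
    have "{m. m < K \<and> x \<le> ys ! m} \<subseteq> {..<i - 1}"
    proof
      fix m assume m: "m \<in> {m. m < K \<and> x \<le> ys ! m}"
      then show "m \<in> {..<i - 1}"
        using desc[of "i - 1" m] False by force
    qed
    then have "card {m. m < K \<and> x \<le> ys ! m} \<le> card {..<i - 1}"
      by (intro card_mono) auto
    with False assms show ?thesis by (simp add: card os)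
  qed
qed

text \<open>Counting is symmetric in the streams, so after this only the conventions of
  \<open>ord_stat\<close> need to be unfolded, not the sorted list. Infinite \<open>y\<close> and
  \<open>i = 0\<close> fit the same criterion; beyond \<open>K\<close> it fails for
  \<open>y = -\<infinity>\<close>, whence the bound on \<open>i\<close>.\<close>

lemma ord_stat_ge_iff:
  assumes "i \<le> K"
  shows "y \<le> ord_stat K v i \<longleftrightarrow> i \<le> card {k. k < K \<and> y \<le> ereal (v k)}"
proof (cases "i = 0")
  case True
  then show ?thesis by (simp add: ord_stat_def)
next
  case False
  have "ord_stat K v i \<noteq> \<infinity>"
    using False assms by (simp add: ord_stat_def)
  then show ?thesis
    using False assms by (cases y) (simp_all add: ord_stat_ge_real_iff)
qed

lemma ord_stat_ge:
  assumes "A \<subseteq> {..<K}" "\<And>k. k \<in> A \<Longrightarrow> x \<le> v k"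
  shows "ereal x \<le> ord_stat K v (card A)"
proof -
  have "card A \<le> card {..<K}"
    by (intro card_mono) (use assms in auto)
  then show ?thesis
    using assms by (subst ord_stat_ge_iff) (auto intro!: card_mono)
qed

lemma ord_stat_le:
  assumes A: "A \<subseteq> {..<K}" "\<And>k. k < K \<Longrightarrow> k \<notin> A \<Longrightarrow> v k \<le> x"
  shows "ord_stat K v (card A + 1) \<le> ereal x"
proof (cases "card A < K")
  case True
  show ?thesis
  proof (rule ccontr)
    assume "\<not> ?thesis"
    \<comment> \<open>The counting criterion decides only non-strict inequalities, so the strict one
      is witnessed by a real level above \<open>x\<close>, which no stream outside \<open>A\<close>
      reaches.\<close>
    then obtain y where y: "x < y" "ereal y \<le> ord_stat K v (card A + 1)"
      by (metis not_le ereal_dense2 less_imp_le ereal_less(2) less_ereal.simps(1))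
    have "card {k. k < K \<and> y \<le> v k} \<le> card A"
      by (intro card_mono finite_subset[OF A(1)]) (use A(2) y in force)+
    with y True show False
      using ord_stat_ge_iff[of "card A + 1" K "ereal y" v] by simp
  qed
next
  case False
  then show ?thesis by (simp add: ord_stat_def)
qed

lemma borel_measurable_ord_stat [measurable (raw)]:
  assumes [measurable]: "\<And>k. k < K \<Longrightarrow> f k \<in> borel_measurable M"
  shows "(\<lambda>\<omega>. ord_stat K (\<lambda>k. f k \<omega>) i) \<in> borel_measurable M"
proof (cases "i \<le> K")
  case True
  \<comment> \<open>As a finite sum of indicators the count is visibly a measurable function of
    \<omega>.\<close>
  have card: "card {k. k < K \<and> P k} = (\<Sum>k<K. if P k then 1 else 0)" for P
    by (simp add: sum.If_cases Int_def conj_commute)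
  have "{\<omega> \<in> space M. y \<le> ord_stat K (\<lambda>k. f k \<omega>) i} \<in> sets M" for y
    unfolding ord_stat_ge_iff[OF True] card by measurable
  then show ?thesis
    by (simp add: borel_measurable_iff_Ici_ereal vimage_def Int_def conj_commute)
next
  case False
  then show ?thesis by (simp add: ord_stat_def)
qed

lemma measurable_pos_count [measurable (raw)]:
  assumes [measurable]: "\<And>k. k < K \<Longrightarrow> f k \<in> borel_measurable M"
  shows "(\<lambda>\<omega>. pos_count K (\<lambda>k. f k \<omega>)) \<in> measurable M (count_space UNIV)"
proof -
  have "pos_count K (\<lambda>k. f k \<omega>) = (\<Sum>k<K. if 0 < f k \<omega> then 1 else 0)" for \<omega>
    by (simp add: pos_count_def sum.If_cases Int_def conj_commute)
  then show ?thesis by simp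
qed

lemma measurable_stop_cond [measurable (raw)]:
  assumes [measurable]: "\<And>k. k < K \<Longrightarrow> f k \<in> borel_measurable M"
  shows "Measurable.pred M (\<lambda>\<omega>. stop_cond K l u a b c d (\<lambda>k. f k \<omega>))"
  unfolding stop_cond_def by measurable

section \<open>The optimal rate and a deterministic criterion for stopping\<close>

locale signal_set =
  fixes K l u :: nat and I J :: "nat \<Rightarrow> real" and A :: "nat set"
  assumes lu: "l \<le> u" "u \<le> K" "0 < u" "l < K"
    and IJ_pos: "\<And>k. k < K \<Longrightarrow> 0 < I k \<and> 0 < J k"
    and A: "A \<in> Pi_lu K l u"
begin

abbreviation "IA \<equiv> Min (I ` A)"
abbreviation "JA \<equiv> Min (J ` ({..<K} - A))"

text \<open>The weights of \<open>|log \<alpha>|\<close> and \<open>|log \<beta>|\<close> in the optimal rate; the value \<open>0\<close> accounts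
  for the convention that a minimum over the empty set is infinite.\<close>

definition w1 :: real where
  "w1 = (if A = {} then 0 else 1 / (IA + (if card A = l then JA else 0)))"

definition w2 :: real where
  "w2 = (if {..<K} - A = {} then 0 else 1 / (JA + (if card A = u then IA else 0)))"

lemma A_sub: "A \<subseteq> {..<K}" and card_ge: "l \<le> card A" and card_le: "card A \<le> u"
  using A by (auto simp: Pi_lu_def)

lemma fin_A [simp]: "finite A"
  using A_sub finite_subset by blast

text \<open>The extra term in a denominator is never a minimum over the empty set: since l < K, a
  set of size l misses a stream, and since 0 < u, a set of size u has an element
  (\<open>nonempty\<close>).\<close>

lemma compl_nonempty: "card A = l \<Longrightarrow> {..<K} - A \<noteq> {}"
  using A_sub lu by (metis Diff_eq_empty_iff card_lessThan nless_le subset_antisym)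

lemma nonempty: "card A = u \<Longrightarrow> A \<noteq> {}"
  using lu by auto

lemma full_iff: "{..<K} - A = {} \<Longrightarrow> card A = K"
  using A_sub by (metis Diff_eq_empty_iff card_lessThan subset_antisym)

lemma IA_pos: "A \<noteq> {} \<Longrightarrow> 0 < IA"
  using A_sub IJ_pos by (subst Min_gr_iff) auto

lemma JA_pos: "{..<K} - A \<noteq> {} \<Longrightarrow> 0 < JA"
  using IJ_pos by (subst Min_gr_iff) auto

lemma denom1_pos: "A \<noteq> {} \<Longrightarrow> 0 < IA + (if card A = l then JA else 0)"
  using add_pos_pos[OF IA_pos JA_pos] IA_pos compl_nonempty by simp

lemma denom2_pos: "{..<K} - A \<noteq> {} \<Longrightarrow> 0 < JA + (if card A = u then IA else 0)"
  using add_pos_pos[OF JA_pos IA_pos] JA_pos nonempty by simp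

lemma w1_nonneg: "0 \<le> w1" and w2_nonneg: "0 \<le> w2"
  using denom1_pos denom2_pos by (simp_all add: w1_def w2_def less_imp_le)

text \<open>Since 0 < K, the set and its complement are not both empty. One positive weight is
  enough for the rate to diverge, which makes additive constants negligible.\<close>

lemma w_pos: "0 < w1 \<or> 0 < w2"
proof (cases "A = {}")
  case True
  then have "{..<K} - A \<noteq> {}" using lu by auto
  then show ?thesis using denom2_pos by (simp add: w2_def)
next
  case False
  then show ?thesis using denom1_pos by (simp add: w1_def)
qed

text \<open>A term whose leading minimum is over the empty set is a real number divided by infinity,
  hence 0, which is the value given to the weight. From here on the rate is handled by real
  arithmetic.\<close>

lemma opt_rate_eq: "opt_rate K I J l u A \<alpha> \<beta> = max (w1 * \<bar>ln \<alpha>\<bar>) (w2 * \<bar>ln \<beta>\<bar>)"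
proof -
  have 1: "ereal \<bar>ln \<alpha>\<bar> / (min_over I A + (if card A = l then min_over J ({..<K} - A) else 0))
      = ereal (w1 * \<bar>ln \<alpha>\<bar>)"
  proof (cases "A = {}")
    case True
    then have w: "w1 = 0" unfolding w1_def by simp
    show ?thesis
      unfolding w using True compl_nonempty by (auto simp: min_over_def zero_ereal_def)
  next
    case False
    then have "min_over I A + (if card A = l then min_over J ({..<K} - A) else 0)
        = ereal (IA + (if card A = l then JA else 0))"
      using compl_nonempty by (simp add: min_over_def)
    then show ?thesis using False denom1_pos by (simp add: w1_def)
  qed
  have 2: "ereal \<bar>ln \<beta>\<bar> / (min_over J ({..<K} - A) + (if card A = u then min_over I A else 0))
      = ereal (w2 * \<bar>ln \<beta>\<bar>)"
  proof (cases "{..<K} - A = {}")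
    case True
    then have w: "w2 = 0" unfolding w2_def by simp
    show ?thesis
      unfolding w using True nonempty by (auto simp: min_over_def zero_ereal_def)
  next
    case False
    then have "min_over J ({..<K} - A) + (if card A = u then min_over I A else 0)
        = ereal (JA + (if card A = u then IA else 0))"
      using nonempty by (simp add: min_over_def)
    then show ?thesis using False denom2_pos by (simp add: w2_def)
  qed
  show ?thesis
    unfolding opt_rate_def 1 2 by (simp add: max_def)
qed

text \<open>Here \<open>s\<close> stands for (1 - \<eta>) n. The values in \<open>A\<close> are at
  least \<open>s * IA\<close> and the others at most \<open>- (s * JA)\<close>, so the order
  statistics on the two sides of the cut at |A| are at least s (IA + JA) apart. If l < |A| < u,
  every stream crosses its own threshold; if |A| is extremal, a gap rule applies, and this is why
  the other minimum enters the weight.\<close>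

lemma stop_cond_of_drift:
  assumes s: "0 < s"
    and vin: "\<And>i. i \<in> A \<Longrightarrow> s * I i < v i"
    and vout: "\<And>j. j < K \<Longrightarrow> j \<notin> A \<Longrightarrow> s * J j < - v j"
    and s1: "w1 * max a c \<le> s" and s2: "w2 * max b d \<le> s"
  shows "stop_cond K l u a b c d v"
proof -
  have vI: "s * IA \<le> v i" if "i \<in> A" for i
  proof -
    have "s * IA \<le> s * I i" using that s by (intro mult_left_mono) auto
    with vin[OF that] show ?thesis by simp
  qed
  have vJ: "v j \<le> - (s * JA)" if "j < K" "j \<notin> A" for j
  proof -
    have "s * JA \<le> s * J j" using that s by (intro mult_left_mono) auto
    with vout[OF that] show ?thesis by simp
  qed
  have top: "ereal (s * IA) \<le> ord_stat K v (card A)"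
    using A_sub vI by (rule ord_stat_ge)
  have bot: "ord_stat K v (card A + 1) \<le> ereal (- (s * JA))"
    using A_sub vJ by (rule ord_stat_le)
  have pos: "0 < v k \<longleftrightarrow> k \<in> A" if "k < K" for k
  proof (cases "k \<in> A")
    case True
    have "0 < s * I k" using s IJ_pos[OF that] by simp
    with vin[OF True] True show ?thesis by simp
  next
    case False
    have "0 < s * J k" using s IJ_pos[OF that] by simp
    with vout[OF that False] False show ?thesis by simp
  qed
  \<comment> \<open>The weights are reciprocals of the margins, so \<open>s1\<close> and
    \<open>s2\<close> say that the margins reach the thresholds.\<close>
  have c1: "max a c \<le> s * (IA + (if card A = l then JA else 0))" if "A \<noteq> {}"
    using s1 that denom1_pos[OF that] by (simp add: w1_def pos_divide_le_eq)
  have c2: "max b d \<le> s * (JA + (if card A = u then IA else 0))" if "{..<K} - A \<noteq> {}"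
    using s2 that denom2_pos[OF that] by (simp add: w2_def pos_divide_le_eq)
  consider (eq) "l = u" | (low) "l < u" "card A = l" | (high) "l < u" "card A = u"
    | (mid) "l < u" "l < card A" "card A < u"
    using card_ge card_le lu by linarith
  then show ?thesis
  proof cases
    case eq
    then have cA: "card A = l" "card A = u" using card_ge card_le by auto
    have "ereal (max c d) \<le> ereal (s * IA) - ereal (- (s * JA))"
      using c1[OF nonempty] c2[OF compl_nonempty] cA by (simp add: algebra_simps)
    also have "\<dots> \<le> ord_stat K v l - ord_stat K v (l + 1)"
      using top bot cA by (intro ereal_minus_mono) auto
    finally show ?thesis using eq by (simp add: stop_cond_def)
  next
    case low
    have b: "b \<le> s * JA" using c2[OF compl_nonempty] low by simp
    have "ereal (- (s * JA)) \<le> ereal (- c) + ord_stat K v l"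
    proof (cases "A = {}")
      \<comment> \<open>Here l = 0, and the convention that the order statistic with index 0 is
        \<infinity> makes the gap condition vacuous.\<close>
      case True
      then show ?thesis using low by (simp add: ord_stat_def)
    next
      case False
      have "ereal (- (s * JA)) \<le> ereal (- c) + ereal (s * IA)"
        using c1[OF False] low by (simp add: algebra_simps)
      also have "\<dots> \<le> ereal (- c) + ord_stat K v l"
        using top low by (intro add_left_mono) simp
      finally show ?thesis .
    qed
    moreover have "ereal (- (s * JA)) \<le> ereal (- b)" using b by simp
    ultimately have "ord_stat K v (l + 1) \<le> min (ereal (- b)) (ereal (- c) + ord_stat K v l)"
      using bot low by (auto intro: order_trans)
    then show ?thesis using low by (simp add: stop_cond_def)
  next
    case high
    have a: "a \<le> s * IA" using c1[OF nonempty] high by simp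
    have "ereal d + ord_stat K v (u + 1) \<le> ereal (s * IA)"
    proof (cases "{..<K} - A = {}")
      \<comment> \<open>There is no noise stream, so u = K and the order statistic with index u + 1
        is -\<infinity>.\<close>
      case True
      then have "u = K" using high full_iff by simp
      then show ?thesis by (simp add: ord_stat_def)
    next
      case False
      have "ereal d + ord_stat K v (u + 1) \<le> ereal d + ereal (- (s * JA))"
        using bot high by (intro add_left_mono) simp
      also have "\<dots> \<le> ereal (s * IA)"
        using c2[OF False] high by (simp add: algebra_simps)
      finally show ?thesis .
    qed
    moreover have "ereal a \<le> ereal (s * IA)" using a by simp
    ultimately have "max (ereal a) (ereal d + ord_stat K v (u + 1)) \<le> ord_stat K v u"
      using top high by (metis max.bounded_iff order_trans)
    then show ?thesis using high by (simp add: stop_cond_def)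
  next
    case mid
    have "v k \<notin> {- b<..<a}" if "k < K" for k
    proof (cases "k \<in> A")
      case True
      then have "a \<le> s * IA" using c1 mid by auto
      with vI[OF True] show ?thesis by simp
    next
      case False
      with that have "b \<le> s * JA" using c2 mid by auto
      with vJ[OF that False] show ?thesis by simp
    qed
    moreover have "pos_count K v = card A"
      unfolding pos_count_def using pos A_sub by (intro arg_cong[where f = card]) auto
    ultimately show ?thesis using mid by (simp add: stop_cond_def)
  qed
qed

end

section \<open>Change of measure\<close>

text \<open>On a box the integral of a product of functions of separate coordinates factorises, and
  boxes determine a finite product measure.\<close>

lemma PiM_density:
  assumes fin: "finite L"
    and M: "\<And>i. i \<in> L \<Longrightarrow> prob_space (M i)"
    and f: "\<And>i. i \<in> L \<Longrightarrow> f i \<in> borel_measurable (M i)"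
    and Mf: "\<And>i. i \<in> L \<Longrightarrow> prob_space (density (M i) (f i))"
  shows "PiM L (\<lambda>i. density (M i) (f i)) = density (PiM L M) (\<lambda>x. \<Prod>i\<in>L. f i (x i))"
proof -
  \<comment> \<open>The locale \<open>product_prob_space\<close> asks for a probability measure at
    every index, so the family is padded outside \<open>L\<close> by a point mass with density
    1.\<close>
  define M' where "M' i = (if i \<in> L then M i else return (count_space UNIV) undefined)" for i
  define f' where "f' i = (if i \<in> L then f i else (\<lambda>_. 1))" for i
  have M': "prob_space (M' i)" for i
    by (auto simp: M'_def M intro!: prob_space_return)
  have f' [measurable]: "f' i \<in> borel_measurable (M' i)" for i
    using f by (auto simp: M'_def f'_def)
  have Mf': "prob_space (density (M' i) (f' i))" for i
    using Mf M' by (cases "i \<in> L") (auto simp: M'_def f'_def density_1 intro!: prob_space_return)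
  interpret M': product_prob_space M' L
    using M' by (intro product_prob_spaceI)
  interpret Mf': product_prob_space "\<lambda>i. density (M' i) (f' i)" L
    using Mf' by (intro product_prob_spaceI)
  have "density (PiM L M') (\<lambda>x. \<Prod>i\<in>L. f' i (x i)) = PiM L (\<lambda>i. density (M' i) (f' i))"
  proof (rule Mf'.PiM_eqI[OF fin])
    show "sets (density (Pi\<^sub>M L M') (\<lambda>x. \<Prod>i\<in>L. f' i (x i))) = sets (Pi\<^sub>M L (\<lambda>i. density (M' i) (f' i)))"
      by (simp cong: sets_PiM_cong)
    fix S assume "\<And>i. i \<in> L \<Longrightarrow> S i \<in> sets (density (M' i) (f' i))"
    then have S [measurable]: "\<And>i. i \<in> L \<Longrightarrow> S i \<in> sets (M' i)" by simp
    have ind: "indicator (Pi\<^sub>E L S) x = (\<Prod>i\<in>L. indicator (S i) (x i) :: ennreal)"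
      if "x \<in> space (PiM L M')" for x
      using that fin by (auto simp: indicator_def space_PiM PiE_iff prod_zero_iff)
    have "emeasure (density (Pi\<^sub>M L M') (\<lambda>x. \<Prod>i\<in>L. f' i (x i))) (Pi\<^sub>E L S)
      = (\<integral>\<^sup>+x. (\<Prod>i\<in>L. f' i (x i)) * indicator (Pi\<^sub>E L S) x \<partial>PiM L M')"
      by (subst emeasure_density) (use fin S in \<open>auto intro!: sets_PiM_I_finite\<close>)
    also have "\<dots> = (\<integral>\<^sup>+x. (\<Prod>i\<in>L. f' i (x i) * indicator (S i) (x i)) \<partial>PiM L M')"
      by (intro nn_integral_cong) (simp add: ind prod.distrib)
    also have "\<dots> = (\<Prod>i\<in>L. \<integral>\<^sup>+x. f' i x * indicator (S i) x \<partial>M' i)"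
      using fin S by (intro M'.product_nn_integral_prod) auto
    also have "\<dots> = (\<Prod>i\<in>L. emeasure (density (M' i) (f' i)) (S i))"
      using S by (intro prod.cong) (auto simp: emeasure_density)
    finally show "emeasure (density (Pi\<^sub>M L M') (\<lambda>x. \<Prod>i\<in>L. f' i (x i))) (Pi\<^sub>E L S)
      = (\<Prod>i\<in>L. emeasure (density (M' i) (f' i)) (S i))" .
  qed
  moreover have "PiM L M' = PiM L M" "PiM L (\<lambda>i. density (M' i) (f' i)) = PiM L (\<lambda>i. density (M i) (f i))"
    by (intro PiM_cong; simp add: M'_def f'_def)+
  moreover have "(\<lambda>x. \<Prod>i\<in>L. f' i (x i)) = (\<lambda>x. \<Prod>i\<in>L. f i (x i))"
    by (simp add: f'_def cong: prod.cong)
  ultimately show ?thesis by simp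
qed

section \<open>Finite observation windows and their likelihood ratios\<close>

lemma measurable_trunc [measurable]: "trunc n \<in> seq_space N \<rightarrow>\<^sub>M fin_space N n"
  unfolding trunc_def[abs_def] seq_space_def fin_space_def
  by (rule measurable_restrict_subset) simp

lemma measurable_trunc_fin: "m \<le> n \<Longrightarrow> trunc m \<in> fin_space N n \<rightarrow>\<^sub>M fin_space N m"
  unfolding trunc_def[abs_def] fin_space_def
  by (rule measurable_restrict_subset) simp

lemma trunc_trunc: "m \<le> n \<Longrightarrow> trunc m (trunc n x) = trunc m x"
  by (simp add: trunc_def Int_absorb1)

lemma measurable_compose_PiM:
  assumes [measurable]: "f \<in> M \<rightarrow>\<^sub>M M'"
  shows "compose L f \<in> PiM L (\<lambda>_. M) \<rightarrow>\<^sub>M PiM L (\<lambda>_. M')"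
  unfolding compose_def[abs_def] by measurable

locale streams =
  fixes K :: nat and N :: "'a measure" and P0 P1 :: "nat \<Rightarrow> (nat \<Rightarrow> 'a) measure"
  assumes laws: "\<And>k. k < K \<Longrightarrow> prob_space (P0 k) \<and> prob_space (P1 k)
                 \<and> sets (P0 k) = sets (seq_space N) \<and> sets (P1 k) = sets (seq_space N)"
    and mac: "\<And>k n. k < K \<Longrightarrow> absolutely_continuous (marg N (P0 k) n) (marg N (P1 k) n)
                 \<and> absolutely_continuous (marg N (P1 k) n) (marg N (P0 k) n)"
begin

abbreviation "jl \<equiv> joint_law K P0 P1"
abbreviation "\<Lambda> \<equiv> jLLR N P0 P1"

definition rd :: "nat \<Rightarrow> nat \<Rightarrow> (nat \<Rightarrow> 'a) \<Rightarrow> ennreal" where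
  "rd k n = RN_deriv (marg N (P0 k) n) (marg N (P1 k) n)"

lemma prob_P: "k < K \<Longrightarrow> prob_space (if k \<in> A then P1 k else P0 k)"
  using laws by simp

lemma sets_P: "k < K \<Longrightarrow> sets (if k \<in> A then P1 k else P0 k) = sets (seq_space N)"
  using laws by simp

lemma sets_joint_law: "sets (jl A) = sets (joint_space K N)"
  unfolding joint_law_def joint_space_def by (intro sets_PiM_cong) (use laws in auto)

lemma space_joint_law: "space (jl A) = space (joint_space K N)"
  by (rule sets_eq_imp_space_eq[OF sets_joint_law])

lemma prob_space_joint_law: "prob_space (jl A)"
  unfolding joint_law_def by (intro prob_space_PiM) (use laws in auto)

lemma measurable_stream:
  "k < K \<Longrightarrow> (\<lambda>\<omega>. \<omega> k) \<in> joint_space K N \<rightarrow>\<^sub>M seq_space N"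
  unfolding joint_space_def by measurable

lemma distr_stream:
  assumes "k < K"
  shows "distr (jl A) (seq_space N) (\<lambda>\<omega>. \<omega> k) = (if k \<in> A then P1 k else P0 k)"
proof -
  have "distr (jl A) (seq_space N) (\<lambda>\<omega>. \<omega> k)
      = distr (jl A) (if k \<in> A then P1 k else P0 k) (\<lambda>\<omega>. \<omega> k)"
    using sets_P[OF assms] by (intro distr_cong) auto
  also have "\<dots> = (if k \<in> A then P1 k else P0 k)"
    unfolding joint_law_def by (rule distr_PiM_component) (use prob_P assms in auto)
  finally show ?thesis .
qed

lemma sets_marg [simp]: "sets (marg N Q n) = sets (fin_space N n)"
  by (simp add: marg_def)

lemma measurable_rd [measurable]: "rd k n \<in> borel_measurable (fin_space N n)"
proof -
  have "rd k n \<in> borel_measurable (marg N (P0 k) n)" by (simp add: rd_def)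
  then show ?thesis by (simp cong: measurable_cong_sets)
qed

lemma prob_marg:
  assumes "prob_space Q" "sets Q = sets (seq_space N)"
  shows "prob_space (marg N Q n)"
proof -
  have "trunc n \<in> Q \<rightarrow>\<^sub>M fin_space N n"
    using measurable_trunc assms(2) by (simp cong: measurable_cong_sets)
  then show ?thesis
    unfolding marg_def by (rule prob_space.prob_space_distr[OF assms(1)])
qed

lemma density_rd:
  assumes "k < K"
  shows "density (marg N (P0 k) n) (rd k n) = marg N (P1 k) n"
proof -
  interpret prob_space "marg N (P0 k) n" using laws[OF assms] by (auto intro: prob_marg)
  show ?thesis
    unfolding rd_def by (rule density_RN_deriv) (use mac[OF assms] in auto)
qed

text \<open>This excludes the points where \<open>enn2real\<close> and \<open>ln\<close> return
  default values. The density is almost surely nonzero under the signal marginal, whose density it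
  is, and absolute continuity carries this over to the noise marginal; finiteness comes from
  \<sigma>-finiteness.\<close>

lemma AE_rd:
  assumes "k < K"
  shows "AE x in marg N (P0 k) n. rd k n x \<noteq> 0 \<and> rd k n x \<noteq> \<infinity>"
proof -
  interpret M0: prob_space "marg N (P0 k) n" using laws[OF assms] by (auto intro: prob_marg)
  interpret M1: prob_space "marg N (P1 k) n" using laws[OF assms] by (auto intro: prob_marg)
  have [measurable]: "rd k n \<in> borel_measurable (marg N (P0 k) n)" by (simp add: rd_def)
  have "AE x in density (marg N (P0 k) n) (rd k n). rd k n x \<noteq> 0"
    by (subst AE_density) auto
  then have "AE x in marg N (P1 k) n. rd k n x \<noteq> 0"
    by (simp only: density_rd[OF assms])
  then have "AE x in marg N (P0 k) n. rd k n x \<noteq> 0"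
    by (rule absolutely_continuous_AE[rotated 2]) (use mac[OF assms] in auto)
  moreover have "AE x in marg N (P0 k) n. rd k n x \<noteq> \<infinity>"
    unfolding rd_def
    by (rule M0.RN_deriv_finite) (use mac[OF assms] M1.sigma_finite_measure_axioms in auto)
  ultimately show ?thesis by eventually_elim simp
qed

text \<open>The noise marginals serve as a common reference for all signal sets, so two hypotheses
  are compared by comparing two densities. Truncation acts on each stream separately, so
  independence survives it.\<close>

lemma distr_joint_law:
  "distr (jl A) (PiM {..<K} (\<lambda>_. fin_space N n)) (compose {..<K} (trunc n))
    = density (PiM {..<K} (\<lambda>k. marg N (P0 k) n)) (\<lambda>y. \<Prod>k<K. if k \<in> A then rd k n (y k) else 1)"
proof -
  have meas: "trunc n \<in> (if k \<in> A then P1 k else P0 k) \<rightarrow>\<^sub>M marg N (P0 k) n" if "k < K" for k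
    using measurable_trunc[of n N] sets_P[OF that, of A] by (simp cong: measurable_cong_sets)
  have [measurable]: "rd k n \<in> borel_measurable (marg N (P0 k) n)" for k by (simp add: rd_def)
  have eq: "distr (if k \<in> A then P1 k else P0 k) (marg N (P0 k) n) (trunc n)
      = density (marg N (P0 k) n) (\<lambda>x. if k \<in> A then rd k n x else 1)" if "k < K" for k
  proof -
    have "distr (if k \<in> A then P1 k else P0 k) (marg N (P0 k) n) (trunc n)
       = marg N (if k \<in> A then P1 k else P0 k) n"
      unfolding marg_def by (intro distr_cong) auto
    then show ?thesis using density_rd[OF that, of n] by (simp add: density_1)
  qed
  have prob0: "prob_space (marg N (P0 k) n)" if "k < K" for k
    using laws[OF that] by (auto intro: prob_marg)
  have "distr (jl A) (PiM {..<K} (\<lambda>_. fin_space N n)) (compose {..<K} (trunc n))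
      = distr (jl A) (PiM {..<K} (\<lambda>k. marg N (P0 k) n)) (compose {..<K} (trunc n))"
    by (intro distr_cong sets_PiM_cong) auto
  also have "\<dots> = PiM {..<K} (\<lambda>k. distr (if k \<in> A then P1 k else P0 k) (marg N (P0 k) n) (trunc n))"
    unfolding joint_law_def
    by (rule distr_PiM_finite_prob_space') (use prob_P prob0 meas in auto)
  also have "\<dots> = PiM {..<K} (\<lambda>k. density (marg N (P0 k) n) (\<lambda>x. if k \<in> A then rd k n x else 1))"
    by (intro PiM_cong eq) auto
  also have "\<dots> = density (PiM {..<K} (\<lambda>k. marg N (P0 k) n)) (\<lambda>y. \<Prod>k<K. if k \<in> A then rd k n (y k) else 1)"
  proof (rule PiM_density)
    fix k assume k: "k \<in> {..<K}"
    show "prob_space (density (marg N (P0 k) n) (\<lambda>x. if k \<in> A then rd k n x else 1))"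
    proof -
      have "prob_space (distr (if k \<in> A then P1 k else P0 k) (marg N (P0 k) n) (trunc n))"
        using k by (intro prob_space.prob_space_distr prob_P meas) simp_all
      with k show ?thesis by (simp only: eq lessThan_iff)
    qed
  qed (use prob0 in auto)
  finally show ?thesis .
qed

lemma measurable_obs: "compose {..<K} (trunc n) \<in> joint_space K N \<rightarrow>\<^sub>M PiM {..<K} (\<lambda>_. fin_space N n)"
  unfolding joint_space_def by (intro measurable_compose_PiM measurable_trunc)

lemma obs_filt_eq: "obs_filt K N n = vimage_algebra (space (joint_space K N))
     (compose {..<K} (trunc n)) (PiM {..<K} (\<lambda>_. fin_space N n))"
  unfolding obs_filt_def compose_def[abs_def] ..

lemma space_obs_filt [simp]: "space (obs_filt K N n) = space (joint_space K N)"
  by (simp add: obs_filt_def)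

text \<open>In this form events of F(n) are handed to the change of measure: as preimages of sets of
  truncated observations.\<close>

lemma obs_filt_iff: "E \<in> sets (obs_filt K N n) \<longleftrightarrow>
   (\<exists>B\<in>sets (PiM {..<K} (\<lambda>_. fin_space N n)). E = compose {..<K} (trunc n) -` B \<inter> space (joint_space K N))"
  unfolding obs_filt_eq using measurable_space[OF measurable_obs]
  by (subst sets_vimage_algebra2) auto

lemma sets_obs_filt_joint: "E \<in> sets (obs_filt K N n) \<Longrightarrow> E \<in> sets (joint_space K N)"
  using measurable_sets[OF measurable_obs] by (auto simp: obs_filt_iff)

lemma measurable_LLR: "k < K \<Longrightarrow> LLR N (P0 k) (P1 k) n \<in> borel_measurable (seq_space N)"
  unfolding LLR_def[abs_def] rd_def[symmetric] by measurable

lemma measurable_jLLR: "k < K \<Longrightarrow> \<Lambda> k n \<in> borel_measurable (joint_space K N)"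
  unfolding jLLR_def[abs_def] using measurable_compose[OF measurable_stream measurable_LLR] by simp

text \<open>The case m < n matters too: that the rule has not stopped before n is an event about
  earlier ratios.\<close>

lemma measurable_jLLR_obs:
  assumes "k < K" "m \<le> n"
  shows "\<Lambda> k m \<in> borel_measurable (obs_filt K N n)"
proof -
  have c: "compose {..<K} (trunc n) \<in> obs_filt K N n \<rightarrow>\<^sub>M PiM {..<K} (\<lambda>_. fin_space N n)"
    unfolding obs_filt_eq using measurable_space[OF measurable_obs]
    by (intro measurable_vimage_algebra1) auto
  have [measurable]: "(\<lambda>y. y k) \<in> PiM {..<K} (\<lambda>_. fin_space N n) \<rightarrow>\<^sub>M fin_space N n"
    using assms(1) by (intro measurable_component_singleton) simp
  have "(\<lambda>y. ln (enn2real (rd k m (trunc m (y k))))) \<in> borel_measurable (PiM {..<K} (\<lambda>_. fin_space N n))"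
    using measurable_trunc_fin[OF assms(2)] by measurable
  from measurable_compose[OF c this]
  have "(\<lambda>\<omega>. ln (enn2real (rd k m (trunc m (compose {..<K} (trunc n) \<omega> k))))) \<in> borel_measurable (obs_filt K N n)" .
  then show ?thesis
    using assms by (simp add: jLLR_def[abs_def] LLR_def rd_def compose_def trunc_trunc)
qed

text \<open>The log-likelihood ratio of P_A against P_C, computed through the all-noise law; streams
  that belong to both sets cancel.\<close>

definition logratio :: "nat set \<Rightarrow> nat set \<Rightarrow> nat \<Rightarrow> (nat \<Rightarrow> nat \<Rightarrow> 'a) \<Rightarrow> real" where
  "logratio A C n \<omega> = (\<Sum>k<K. (if k \<in> A then \<Lambda> k n \<omega> else 0) - (if k \<in> C then \<Lambda> k n \<omega> else 0))"

lemma measurable_logratio [measurable]: "logratio A C n \<in> borel_measurable (joint_space K N)"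
  unfolding logratio_def[abs_def] using measurable_jLLR by measurable

text \<open>Where the log-likelihood ratio is at most \<open>x\<close>, the density of P_A is at
  most exp x times that of P_C; integrate over the event.\<close>

lemma change_of_measure:
  assumes E: "E \<in> sets (obs_filt K N n)"
  shows "emeasure (jl A) (E \<inter> {\<omega>. logratio A C n \<omega> \<le> x}) \<le> ennreal (exp x) * emeasure (jl C) E"
proof -
  obtain B where B [measurable]: "B \<in> sets (PiM {..<K} (\<lambda>_. fin_space N n))"
    and EB: "E = compose {..<K} (trunc n) -` B \<inter> space (joint_space K N)"
    using E by (auto simp: obs_filt_iff)
  define Q where "Q = PiM {..<K} (\<lambda>k. marg N (P0 k) n)"
  have sets_Q [measurable_cong]: "sets Q = sets (PiM {..<K} (\<lambda>_. fin_space N n))"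
    unfolding Q_def by (intro sets_PiM_cong) auto
  define lam where "lam k y = ln (enn2real (rd k n (y k)))" for k and y :: "nat \<Rightarrow> nat \<Rightarrow> 'a"
  define z where "z y = (\<Sum>k<K. (if k \<in> A then lam k y else 0) - (if k \<in> C then lam k y else 0))" for y
  define g where "g S y = (\<Prod>k<K. if k \<in> S then rd k n (y k) else 1)" for S and y :: "nat \<Rightarrow> nat \<Rightarrow> 'a"
  have [measurable]: "k < K \<Longrightarrow> lam k \<in> borel_measurable Q" for k
    unfolding lam_def by measurable
  have [measurable]: "z \<in> borel_measurable Q" "g S \<in> borel_measurable Q" for S
    unfolding z_def[abs_def] g_def[abs_def] by measurable
  have obs: "compose {..<K} (trunc n) \<in> jl S \<rightarrow>\<^sub>M PiM {..<K} (\<lambda>_. fin_space N n)" for S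
    using measurable_obs sets_joint_law by (simp cong: measurable_cong_sets)
  have law: "emeasure (jl S) (compose {..<K} (trunc n) -` B' \<inter> space (joint_space K N))
      = (\<integral>\<^sup>+y. g S y * indicator B' y \<partial>Q)" if [measurable]: "B' \<in> sets Q" for S B'
  proof -
    have "emeasure (jl S) (compose {..<K} (trunc n) -` B' \<inter> space (joint_space K N))
        = emeasure (distr (jl S) (PiM {..<K} (\<lambda>_. fin_space N n)) (compose {..<K} (trunc n))) B'"
      using that by (subst emeasure_distr[OF obs]) (auto simp: sets_Q space_joint_law)
    also have "\<dots> = emeasure (density Q (g S)) B'"
      by (simp add: distr_joint_law Q_def g_def[abs_def])
    also have "\<dots> = (\<integral>\<^sup>+y. g S y * indicator B' y \<partial>Q)"
      by (subst emeasure_density) auto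
    finally show ?thesis .
  qed
  have prob0: "prob_space (marg N (P0 k) n)" if "k < K" for k
    using laws[OF that] by (auto intro: prob_marg)
  have "AE y in Q. \<forall>k\<in>{..<K}. rd k n (y k) \<noteq> 0 \<and> rd k n (y k) \<noteq> \<infinity>"
    unfolding Q_def
    by (intro AE_finite_allI AE_PiM_component[where P = "\<lambda>x. rd _ n x \<noteq> 0 \<and> rd _ n x \<noteq> \<infinity>"] AE_rd)
       (auto intro: prob0)
  then have dens: "AE y in Q. g A y * indicator (B \<inter> {y. z y \<le> x}) y \<le> ennreal (exp x) * (g C y * indicator B y)"
  proof eventually_elim
    case (elim y)
    \<comment> \<open>Off the excluded null set the density is positive and finite, so
      \<open>exp\<close> really inverts \<open>ln\<close>.\<close>
    have r: "rd k n (y k) = ennreal (exp (lam k y))" if "k < K" for k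
    proof -
      have "0 < enn2real (rd k n (y k))"
        using elim that by (simp add: enn2real_positive_iff less_top zero_less_iff_neq_zero)
      then show ?thesis
        using elim that by (simp add: lam_def ennreal_enn2real less_top)
    qed
    have g: "g S y = ennreal (exp (\<Sum>k<K. if k \<in> S then lam k y else 0))" for S
    proof -
      have "g S y = (\<Prod>k<K. ennreal (exp (if k \<in> S then lam k y else 0)))"
        unfolding g_def by (intro prod.cong) (auto simp: r)
      then show ?thesis by (simp add: prod_ennreal exp_sum)
    qed
    have "g A y \<le> ennreal (exp x) * g C y" if "z y \<le> x"
      using that by (simp add: g z_def sum_subtractf algebra_simps flip: ennreal_mult' exp_add)
    then show ?case by (auto simp: indicator_def)
  qed
  have E': "E \<inter> {\<omega>. logratio A C n \<omega> \<le> x}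
      = compose {..<K} (trunc n) -` (B \<inter> {y. z y \<le> x}) \<inter> space (joint_space K N)"
  proof -
    have "logratio A C n \<omega> = z (compose {..<K} (trunc n) \<omega>)" for \<omega>
      unfolding logratio_def z_def
      by (intro sum.cong) (simp_all add: lam_def jLLR_def LLR_def rd_def compose_def)
    then show ?thesis by (auto simp: EB)
  qed
  have "{y \<in> space Q. z y \<le> x} \<inter> B \<in> sets Q" by measurable
  moreover have "{y \<in> space Q. z y \<le> x} \<inter> B = B \<inter> {y. z y \<le> x}"
    using sets.sets_into_space[OF B] sets_eq_imp_space_eq[OF sets_Q] by auto
  ultimately have B': "B \<inter> {y. z y \<le> x} \<in> sets Q" by simp
  have "emeasure (jl A) (E \<inter> {\<omega>. logratio A C n \<omega> \<le> x})
      \<le> (\<integral>\<^sup>+y. ennreal (exp x) * (g C y * indicator B y) \<partial>Q)"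
    unfolding E' law[OF B'] by (intro nn_integral_mono_AE dens)
  also have "\<dots> = ennreal (exp x) * emeasure (jl C) E"
    by (simp add: nn_integral_cmult EB law)
  finally show ?thesis .
qed

end

section \<open>Bounds on expected stopping times\<close>

text \<open>For almost every \<omega> all times from a random m on satisfy Z n \<le> r n \<le> r h,
  and the finitely many earlier values are below r h once h is large. So the indicator of the event
  tends to 0 pointwise, and dominated convergence applies.\<close>

lemma (in prob_space) prob_running_max_tendsto_0:
  fixes Z :: "nat \<Rightarrow> 'a \<Rightarrow> real"
  assumes Z [measurable]: "\<And>n. Z n \<in> borel_measurable M"
    and r: "0 < r" and ev: "AE \<omega> in M. \<forall>\<^sub>F n in sequentially. Z n \<omega> \<le> r * real n"
  shows "(\<lambda>h. prob {\<omega> \<in> space M. \<exists>n\<in>{1..h}. r * real h < Z n \<omega>}) \<longlonglongrightarrow> 0"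
proof -
  define B where "B h = {\<omega> \<in> space M. \<exists>n\<in>{1..h}. r * real h < Z n \<omega>}" for h
  have [measurable]: "B h \<in> sets M" for h unfolding B_def by measurable
  have "AE \<omega> in M. (\<lambda>h. indicator (B h) \<omega> :: real) \<longlonglongrightarrow> 0"
    using ev
  proof eventually_elim
    case (elim \<omega>)
    then obtain m where m: "\<And>n. m \<le> n \<Longrightarrow> Z n \<omega> \<le> r * real n"
      by (auto simp: eventually_sequentially)
    have "\<forall>\<^sub>F h in sequentially. \<forall>n\<in>{..<m}. Z n \<omega> \<le> r * real h"
    proof (intro eventually_ball_finite ballI)
      fix n
      have "filterlim (\<lambda>h. r * real h) at_top sequentially"
        using r by (intro filterlim_tendsto_pos_mult_at_top[OF tendsto_const]) (auto intro: filterlim_real_sequentially)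
      then show "\<forall>\<^sub>F h in sequentially. Z n \<omega> \<le> r * real h"
        by (simp add: filterlim_at_top)
    qed simp
    then have "\<forall>\<^sub>F h in sequentially. indicator (B h) \<omega> = (0 :: real)"
    proof eventually_elim
      case (elim h)
      have "Z n \<omega> \<le> r * real h" if "n \<le> h" for n
      proof (cases "n < m")
        case True
        then show ?thesis using elim by auto
      next
        case False
        then have "Z n \<omega> \<le> r * real n" using m by simp
        also have "\<dots> \<le> r * real h" using that r by simp
        finally show ?thesis .
      qed
      then show ?case by (auto simp: B_def indicator_def not_less)
    qed
    then show ?case by (rule tendsto_eventually)
  qed
  then have "(\<lambda>h. \<integral>\<omega>. indicator (B h) \<omega> \<partial>M) \<longlonglongrightarrow> (\<integral>\<omega>. 0 \<partial>M :: real)"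
    by (intro integral_dominated_convergence[where w = "\<lambda>_. 1"]) (auto simp: indicator_def)
  then show ?thesis by (simp add: B_def)
qed

lemma filterlim_abs_ln_at_right_0: "filterlim (\<lambda>x. \<bar>ln x :: real\<bar>) at_top (at_right 0)"
proof -
  have "filterlim (\<lambda>x. \<bar>- ln x :: real\<bar>) at_top (at_right 0)"
    by (intro filterlim_compose[OF filterlim_abs_real]
          filterlim_compose[OF filterlim_uminus_at_top_at_bot] ln_at_0)
  then show ?thesis by simp
qed

context streams
begin

text \<open>Stopping by \<open>h\<close> happens in one of three ways: \<open>S\<close> fails, the
  log-likelihood ratio exceeds \<open>x\<close> at some time up to \<open>h\<close>, or
  \<open>S\<close> holds on stopping while the ratio is at most \<open>x\<close>. The last is moved
  to P_C at the cost exp x. \<open>S\<close> is abstract because both a decision and its negation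
  are used.\<close>

lemma prob_stop_le:
  assumes T0: "\<And>\<omega>. \<omega> \<in> space (joint_space K N) \<Longrightarrow> T \<omega> \<noteq> 0"
    and T: "\<And>n. {\<omega> \<in> space (joint_space K N). T \<omega> = enat n} \<in> sets (obs_filt K N n)"
    and S: "\<And>n. {\<omega> \<in> space (joint_space K N). T \<omega> = enat n \<and> S \<omega>} \<in> sets (obs_filt K N n)"
    and e1: "measure (jl A) {\<omega> \<in> space (jl A). T \<omega> \<noteq> \<infinity> \<and> \<not> S \<omega>} \<le> \<epsilon>1"
    and e2: "measure (jl C) {\<omega> \<in> space (jl C). T \<omega> \<noteq> \<infinity> \<and> S \<omega>} \<le> \<epsilon>2"
  shows "measure (jl A) {\<omega> \<in> space (jl A). T \<omega> \<le> enat h}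
    \<le> \<epsilon>1 + exp x * \<epsilon>2 + measure (jl A) {\<omega> \<in> space (jl A). \<exists>n\<in>{1..h}. x < logratio A C n \<omega>}"
proof -
  interpret A: prob_space "jl A" by (rule prob_space_joint_law)
  interpret C: prob_space "jl C" by (rule prob_space_joint_law)
  define \<Omega> where "\<Omega> = space (joint_space K N)"
  have sp: "space (jl B) = \<Omega>" for B by (simp add: \<Omega>_def space_joint_law)
  define G where "G n = {\<omega> \<in> \<Omega>. T \<omega> = enat n \<and> S \<omega>}" for n
  define H where "H n = {\<omega> \<in> \<Omega>. T \<omega> = enat n}" for n
  have G: "G n \<in> sets (obs_filt K N n)" for n using S[of n] by (simp add: G_def \<Omega>_def)
  have Gj [measurable]: "G n \<in> sets (jl B)" "H n \<in> sets (jl B)" for n B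
    using sets_obs_filt_joint[OF S] sets_obs_filt_joint[OF T] by (simp_all add: G_def H_def \<Omega>_def sets_joint_law)
  have [measurable]: "logratio A C n \<in> borel_measurable (jl B)" for n B
    using measurable_logratio sets_joint_law by (simp cong: measurable_cong_sets)
  define E1 where "E1 = (\<Union>n. H n - G n)"
  define L where "L n = {\<omega> \<in> space (jl A). logratio A C n \<omega> \<le> x}" for n
  define U where "U = (\<Union>n\<in>{1..h}. G n \<inter> L n)"
  define V where "V = {\<omega> \<in> space (jl A). \<exists>n\<in>{1..h}. x < logratio A C n \<omega>}"
  have [measurable]: "E1 \<in> sets (jl A)" "L n \<in> sets (jl A)" "U \<in> sets (jl A)" "V \<in> sets (jl A)" for n
    unfolding E1_def L_def U_def V_def by measurable
  have E1: "E1 = {\<omega> \<in> space (jl A). T \<omega> \<noteq> \<infinity> \<and> \<not> S \<omega>}"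
    by (auto simp: E1_def G_def H_def sp)
  have "{\<omega> \<in> space (jl A). T \<omega> \<le> enat h} \<subseteq> (E1 \<union> U) \<union> V"
  proof
    fix \<omega> assume w: "\<omega> \<in> {\<omega> \<in> space (jl A). T \<omega> \<le> enat h}"
    then obtain n where n: "T \<omega> = enat n" "n \<le> h" by (cases "T \<omega>") auto
    with w T0[of \<omega>] have "1 \<le> n" by (auto simp: sp \<Omega>_def zero_enat_def)
    with w n show "\<omega> \<in> (E1 \<union> U) \<union> V"
      by (auto simp: E1_def G_def H_def U_def V_def L_def sp not_le)
  qed
  then have "measure (jl A) {\<omega> \<in> space (jl A). T \<omega> \<le> enat h} \<le> measure (jl A) ((E1 \<union> U) \<union> V)"
    by (intro A.finite_measure_mono) auto
  also have "\<dots> \<le> measure (jl A) (E1 \<union> U) + measure (jl A) V"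
    by (intro measure_Un_le) auto
  also have "measure (jl A) (E1 \<union> U) \<le> measure (jl A) E1 + measure (jl A) U"
    by (intro measure_Un_le) auto
  also have "measure (jl A) E1 \<le> \<epsilon>1" using e1 by (simp add: E1)
  also have "measure (jl A) U \<le> exp x * \<epsilon>2"
  proof -
    have "measure (jl A) U \<le> (\<Sum>n\<in>{1..h}. measure (jl A) (G n \<inter> L n))"
      unfolding U_def by (intro A.finite_measure_subadditive_finite) auto
    also have "\<dots> \<le> (\<Sum>n\<in>{1..h}. exp x * measure (jl C) (G n))"
    proof (intro sum_mono)
      fix n
      have "G n \<inter> L n = G n \<inter> {\<omega>. logratio A C n \<omega> \<le> x}"
        by (auto simp: L_def G_def sp)
      then have "ennreal (measure (jl A) (G n \<inter> L n)) \<le> ennreal (exp x * measure (jl C) (G n))"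
        using change_of_measure[OF G, of A n C x]
        by (simp add: A.emeasure_eq_measure C.emeasure_eq_measure ennreal_mult')
      then show "measure (jl A) (G n \<inter> L n) \<le> exp x * measure (jl C) (G n)"
        by (subst (asm) ennreal_le_iff) auto
    qed
    \<comment> \<open>Stopping at different times gives disjoint events, so summing over time costs
      no factor \<open>h\<close>.\<close>
    also have "\<dots> = exp x * measure (jl C) (\<Union>n\<in>{1..h}. G n)"
      by (subst C.finite_measure_finite_Union) (auto simp: sum_distrib_left disjoint_family_on_def G_def[abs_def] intro: Gj[unfolded G_def])
    also have "measure (jl C) (\<Union>n\<in>{1..h}. G n) \<le> measure (jl C) {\<omega> \<in> space (jl C). T \<omega> \<noteq> \<infinity> \<and> S \<omega>}"
    proof (intro C.finite_measure_mono)
      have "{\<omega> \<in> space (jl C). T \<omega> \<noteq> \<infinity> \<and> S \<omega>} = (\<Union>n. G n)"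
        by (auto simp: G_def sp)
      then show "{\<omega> \<in> space (jl C). T \<omega> \<noteq> \<infinity> \<and> S \<omega>} \<in> sets (jl C)" by simp
    qed (auto simp: G_def sp)
    also have "\<dots> \<le> \<epsilon>2" by (rule e2)
    finally show ?thesis by simp
  qed
  finally show ?thesis by (simp add: V_def)
qed

text \<open>Markov's inequality. Rounding down loses nothing, since an integer above the floor of
  \<theta> is above \<theta>.\<close>

lemma exp_time_ge:
  assumes T: "\<And>n. {\<omega> \<in> space (joint_space K N). T \<omega> = enat n} \<in> sets (obs_filt K N n)"
    and \<theta>: "0 \<le> \<theta>"
  shows "ennreal (\<theta> * (1 - measure (jl A) {\<omega> \<in> space (jl A). T \<omega> \<le> enat (nat \<lfloor>\<theta>\<rfloor>)})) \<le> exp_time K P0 P1 A T"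
proof -
  interpret A: prob_space "jl A" by (rule prob_space_joint_law)
  define L where "L = {\<omega> \<in> space (jl A). T \<omega> \<le> enat (nat \<lfloor>\<theta>\<rfloor>)}"
  have le_enat: "t \<le> enat m \<longleftrightarrow> (\<exists>n\<le>m. t = enat n)" for t m
    by (cases t) auto
  have "L = (\<Union>n\<le>nat \<lfloor>\<theta>\<rfloor>. {\<omega> \<in> space (joint_space K N). T \<omega> = enat n})"
    unfolding L_def le_enat space_joint_law by auto
  then have [measurable]: "L \<in> sets (jl A)"
    using sets_obs_filt_joint[OF T] by (auto simp: sets_joint_law)
  have "ennreal (\<theta> * (1 - measure (jl A) L)) = ennreal \<theta> * emeasure (jl A) (space (jl A) - L)"
    using \<theta> by (simp add: A.prob_compl[symmetric] A.emeasure_eq_measure ennreal_mult')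
  also have "\<dots> = (\<integral>\<^sup>+\<omega>. ennreal \<theta> * indicator (space (jl A) - L) \<omega> \<partial>jl A)"
    by (subst nn_integral_cmult_indicator) auto
  also have "\<dots> \<le> (\<integral>\<^sup>+\<omega>. ennreal_of_enat (T \<omega>) \<partial>jl A)"
  proof (intro nn_integral_mono)
    fix \<omega>
    have "ennreal \<theta> \<le> ennreal_of_enat (T \<omega>)" if "enat (nat \<lfloor>\<theta>\<rfloor>) < T \<omega>"
    proof (cases "T \<omega>")
      case (enat t)
      with that have "\<theta> \<le> real t" by (simp add: nat_less_iff floor_less_iff \<theta> le_floor_iff)
      then have "ennreal \<theta> \<le> ennreal (real t)" by (rule ennreal_leI)
      then show ?thesis by (simp add: enat ennreal_of_nat_eq_real_of_nat)
    qed simp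
    then show "ennreal \<theta> * indicator (space (jl A) - L) \<omega> \<le> ennreal_of_enat (T \<omega>)"
      by (auto simp: indicator_def L_def)
  qed
  finally show ?thesis by (simp add: exp_time_def L_def)
qed

text \<open>The range of \<open>\<epsilon>2\<close> is fixed before \<open>\<epsilon>1\<close>,
  \<open>T\<close> and \<open>S\<close>: the bound must be uniform over procedures to survive an
  infimum. With \<open>r = (1 + \<eta>) * R\<close> and h about (1 - \<eta>) |ln \<epsilon>2| / R,
  the level \<open>r * h\<close> is at most (1 - \<eta>^2) |ln \<epsilon>2|, so exp (r h)
  \<epsilon>2 still tends to 0.\<close>

lemma exp_time_lower_bound:
  assumes R: "0 < R" and ev: "\<forall>r>R. AE \<omega> in jl A. \<forall>\<^sub>F n in sequentially. logratio A C n \<omega> \<le> r * real n"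
    and \<delta>: "0 < \<delta>" "\<delta> < 1"
  shows "\<forall>\<^sub>F \<epsilon>2 in at_right 0. \<forall>\<epsilon>1 T S. \<epsilon>1 < \<delta> / 6 \<longrightarrow>
      (\<forall>\<omega>\<in>space (joint_space K N). T \<omega> \<noteq> 0) \<longrightarrow>
      (\<forall>n. {\<omega> \<in> space (joint_space K N). T \<omega> = enat n} \<in> sets (obs_filt K N n)) \<longrightarrow>
      (\<forall>n. {\<omega> \<in> space (joint_space K N). T \<omega> = enat n \<and> S \<omega>} \<in> sets (obs_filt K N n)) \<longrightarrow>
      measure (jl A) {\<omega> \<in> space (jl A). T \<omega> \<noteq> \<infinity> \<and> \<not> S \<omega>} \<le> \<epsilon>1 \<longrightarrow>
      measure (jl C) {\<omega> \<in> space (jl C). T \<omega> \<noteq> \<infinity> \<and> S \<omega>} \<le> \<epsilon>2 \<longrightarrow>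
      ennreal ((1 - \<delta>) * (\<bar>ln \<epsilon>2\<bar> / R)) \<le> exp_time K P0 P1 A T"
proof -
  interpret A: prob_space "jl A" by (rule prob_space_joint_law)
  \<comment> \<open>One factor 1 - \<eta> pays for the shortened horizon and one for the probability
    of stopping early; (1 - \<eta>)^2 \<ge> 1 - 2 \<eta> = 1 - \<delta>.\<close>
  define \<eta> where "\<eta> = \<delta> / 2"
  have \<eta>: "0 < \<eta>" "\<eta> < 1" using \<delta> by (auto simp: \<eta>_def)
  define r where "r = (1 + \<eta>) * R"
  define \<theta> where "\<theta> \<epsilon> = (1 - \<eta>) * (\<bar>ln \<epsilon>\<bar> / R)" for \<epsilon>
  define g where "g h = measure (jl A) {\<omega> \<in> space (jl A). \<exists>n\<in>{1..h}. r * real h < logratio A C n \<omega>}" for h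
  have r: "0 < r" "R < r" using R \<eta> by (auto simp: r_def)
  have [measurable]: "logratio A C n \<in> borel_measurable (jl A)" for n
    using measurable_logratio sets_joint_law by (simp cong: measurable_cong_sets)
  have g0: "g \<longlonglongrightarrow> 0"
    unfolding g_def by (rule A.prob_running_max_tendsto_0) (use r ev in auto)
  note lnlim = filterlim_abs_ln_at_right_0
  have "filterlim \<theta> at_top (at_right 0)"
    unfolding \<theta>_def divide_inverse using \<eta> R
    by (intro filterlim_tendsto_pos_mult_at_top[OF tendsto_const] filterlim_at_top_mult_tendsto_pos[OF tendsto_const] lnlim) auto
  then have "filterlim (\<lambda>\<epsilon>. nat \<lfloor>\<theta> \<epsilon>\<rfloor>) sequentially (at_right 0)"
    by (rule filterlim_compose[OF filterlim_compose[OF filterlim_nat_sequentially filterlim_floor_sequentially]])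
  then have "((\<lambda>\<epsilon>. g (nat \<lfloor>\<theta> \<epsilon>\<rfloor>)) \<longlongrightarrow> 0) (at_right 0)"
    by (rule filterlim_compose[OF g0])
  then have 1: "\<forall>\<^sub>F \<epsilon> in at_right 0. g (nat \<lfloor>\<theta> \<epsilon>\<rfloor>) < \<eta> / 3"
    using \<eta> by (intro order_tendstoD) auto
  have "filterlim (\<lambda>\<epsilon>. \<eta>\<^sup>2 * \<bar>ln \<epsilon> :: real\<bar>) at_top (at_right 0)"
    using \<eta> by (intro filterlim_tendsto_pos_mult_at_top[OF tendsto_const] lnlim) auto
  then have "((\<lambda>\<epsilon>. exp (- (\<eta>\<^sup>2 * \<bar>ln \<epsilon> :: real\<bar>))) \<longlongrightarrow> 0) (at_right 0)"
    by (intro filterlim_compose[OF exp_at_bot] filterlim_compose[OF filterlim_uminus_at_bot_at_top])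
  then have 2: "\<forall>\<^sub>F \<epsilon> in at_right 0. exp (- (\<eta>\<^sup>2 * \<bar>ln \<epsilon> :: real\<bar>)) < \<eta> / 3"
    using \<eta> by (intro order_tendstoD) auto
  have 3: "\<forall>\<^sub>F \<epsilon> in at_right (0::real). \<epsilon> \<in> {0<..<1}"
    by (rule eventually_at_right_real) simp
  from 1 2 3 show ?thesis
  proof (eventually_elim, intro allI impI)
    fix \<epsilon>2 \<epsilon>1 T S
    assume g: "g (nat \<lfloor>\<theta> \<epsilon>2\<rfloor>) < \<eta> / 3" and ex: "exp (- (\<eta>\<^sup>2 * \<bar>ln \<epsilon>2\<bar>)) < \<eta> / 3" and \<epsilon>2: "\<epsilon>2 \<in> {0<..<1}"
      and \<epsilon>1: "\<epsilon>1 < \<delta> / 6"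
      and T0: "\<forall>\<omega>\<in>space (joint_space K N). T \<omega> \<noteq> 0"
      and T: "\<forall>n. {\<omega> \<in> space (joint_space K N). T \<omega> = enat n} \<in> sets (obs_filt K N n)"
      and S: "\<forall>n. {\<omega> \<in> space (joint_space K N). T \<omega> = enat n \<and> S \<omega>} \<in> sets (obs_filt K N n)"
      and e1: "measure (jl A) {\<omega> \<in> space (jl A). T \<omega> \<noteq> \<infinity> \<and> \<not> S \<omega>} \<le> \<epsilon>1"
      and e2: "measure (jl C) {\<omega> \<in> space (jl C). T \<omega> \<noteq> \<infinity> \<and> S \<omega>} \<le> \<epsilon>2"
    define h where "h = nat \<lfloor>\<theta> \<epsilon>2\<rfloor>"
    have \<theta>0: "0 \<le> \<theta> \<epsilon>2" using \<eta> R by (simp add: \<theta>_def)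
    then have "r * real h \<le> r * \<theta> \<epsilon>2"
      using r unfolding h_def by (intro mult_left_mono of_nat_floor) auto
    also have "\<dots> = (1 - \<eta>\<^sup>2) * \<bar>ln \<epsilon>2\<bar>"
      using R by (simp add: r_def \<theta>_def field_simps power2_eq_square)
    finally have rh: "exp (r * real h) \<le> exp ((1 - \<eta>\<^sup>2) * \<bar>ln \<epsilon>2\<bar>)" by simp
    have "exp (r * real h) * \<epsilon>2 \<le> exp ((1 - \<eta>\<^sup>2) * \<bar>ln \<epsilon>2\<bar>) * exp (ln \<epsilon>2)"
      using rh \<epsilon>2 by (intro mult_mono) auto
    also have "\<dots> = exp (- (\<eta>\<^sup>2 * \<bar>ln \<epsilon>2\<bar>))"
      unfolding exp_add[symmetric] using \<epsilon>2 by (simp add: algebra_simps)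
    finally have "exp (r * real h) * \<epsilon>2 < \<eta> / 3" using ex by simp
    moreover have "measure (jl A) {\<omega> \<in> space (jl A). T \<omega> \<le> enat h} \<le> \<epsilon>1 + exp (r * real h) * \<epsilon>2 + g h"
      unfolding g_def by (rule prob_stop_le) (use T0 T S e1 e2 in auto)
    \<comment> \<open>Each of the three terms is below \<eta> / 3; for \<open>\<epsilon>1\<close>
      this is the bound \<delta> / 6.\<close>
    ultimately have P: "measure (jl A) {\<omega> \<in> space (jl A). T \<omega> \<le> enat h} \<le> \<eta>"
      using g \<epsilon>1 by (simp add: h_def \<eta>_def)
    have "(1 - \<delta>) * (\<bar>ln \<epsilon>2\<bar> / R) \<le> (1 - \<eta>)\<^sup>2 * (\<bar>ln \<epsilon>2\<bar> / R)"
      using R by (intro mult_right_mono) (auto simp: \<eta>_def power2_eq_square algebra_simps)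
    also have "\<dots> = \<theta> \<epsilon>2 * (1 - \<eta>)" by (simp add: \<theta>_def power2_eq_square)
    also have "\<dots> \<le> \<theta> \<epsilon>2 * (1 - measure (jl A) {\<omega> \<in> space (jl A). T \<omega> \<le> enat h})"
      using P \<theta>0 by (intro mult_left_mono) auto
    finally have "ennreal ((1 - \<delta>) * (\<bar>ln \<epsilon>2\<bar> / R))
        \<le> ennreal (\<theta> \<epsilon>2 * (1 - measure (jl A) {\<omega> \<in> space (jl A). T \<omega> \<le> enat h}))"
      by (rule ennreal_leI)
    also have "\<dots> \<le> exp_time K P0 P1 A T"
      unfolding h_def using T \<theta>0 by (intro exp_time_ge) auto
    finally show "ennreal ((1 - \<delta>) * (\<bar>ln \<epsilon>2\<bar> / R)) \<le> exp_time K P0 P1 A T" .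
  qed
qed

text \<open>After time \<open>n0\<close> every time before stopping is paid for by a bad event, so
  \<open>T\<close> is at most \<open>n0 + 1\<close> plus the number of bad events. Index
  \<open>n\<close> stands for time n + 1.\<close>

lemma exp_time_upper_bound:
  assumes bad [measurable]: "\<And>k n. k < K \<Longrightarrow> bad k n \<in> sets (jl A)"
    and T: "\<And>\<omega> n. \<omega> \<in> space (jl A) \<Longrightarrow> n0 \<le> n \<Longrightarrow> enat (Suc n) < T \<omega> \<Longrightarrow> \<exists>k<K. \<omega> \<in> bad k n"
  shows "exp_time K P0 P1 A T \<le> of_nat (n0 + 1) + (\<Sum>n. \<Sum>k<K. emeasure (jl A) (bad k n))"
proof -
  define F where "F \<omega> n = (\<Sum>k<K. indicator (bad k n) \<omega> :: ennreal)" for \<omega> n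
  have F1: "1 \<le> F \<omega> n" if w: "\<omega> \<in> space (jl A)" "n0 \<le> n" "enat (Suc n) < T \<omega>" for \<omega> n
  proof -
    obtain k where k: "k < K" "\<omega> \<in> bad k n" using T[OF w] by blast
    have "indicator (bad k n) \<omega> \<le> F \<omega> n"
      unfolding F_def using k by (intro member_le_sum) auto
    with k show ?thesis by simp
  qed
  have le: "of_nat m \<le> of_nat (n0 + 1) + (\<Sum>n. F \<omega> n)" if w: "\<omega> \<in> space (jl A)" "enat m \<le> T \<omega>" for \<omega> m
  proof -
    have "of_nat m \<le> (of_nat (n0 + 1 + card {n0..<m - 1}) :: ennreal)"
      by (intro of_nat_mono) simp
    also have "\<dots> = of_nat (n0 + 1) + (\<Sum>n\<in>{n0..<m - 1}. 1)" by simp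
    also have "\<dots> \<le> of_nat (n0 + 1) + (\<Sum>n\<in>{n0..<m - 1}. F \<omega> n)"
    proof (intro add_left_mono sum_mono F1 w(1))
      fix n assume n: "n \<in> {n0..<m - 1}"
      then have "enat (Suc n) < enat m" by auto
      with w show "enat (Suc n) < T \<omega>" by (rule_tac less_le_trans)
    qed auto
    also have "\<dots> \<le> of_nat (n0 + 1) + (\<Sum>n. F \<omega> n)"
      by (intro add_left_mono sum_le_suminf) auto
    finally show ?thesis .
  qed
  have "exp_time K P0 P1 A T \<le> (\<integral>\<^sup>+\<omega>. of_nat (n0 + 1) + (\<Sum>n. F \<omega> n) \<partial>jl A)"
    unfolding exp_time_def
  proof (intro nn_integral_mono)
    fix \<omega> assume w: "\<omega> \<in> space (jl A)"
    show "ennreal_of_enat (T \<omega>) \<le> of_nat (n0 + 1) + (\<Sum>n. F \<omega> n)"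
    proof (cases "T \<omega>")
      case (enat t)
      then show ?thesis using le[OF w, of t] by simp
    next
      \<comment> \<open>If \<open>T\<close> is infinite, the bound holds for every \<open>m\<close>,
        so its right-hand side is infinite as well.\<close>
      case infinity
      then have "(SUP m. of_nat m :: ennreal) \<le> of_nat (n0 + 1) + (\<Sum>n. F \<omega> n)"
        using le[OF w] by (intro SUP_least) simp
      then show ?thesis using infinity by (simp add: ennreal_SUP_of_nat_eq_top top_unique)
    qed
  qed
  also have "\<dots> = of_nat (n0 + 1) + (\<Sum>n. \<Sum>k<K. emeasure (jl A) (bad k n))"
  proof -
    interpret A: prob_space "jl A" by (rule prob_space_joint_law)
    have "(\<integral>\<^sup>+\<omega>. of_nat (n0 + 1) + (\<Sum>n. F \<omega> n) \<partial>jl A)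
        = of_nat (n0 + 1) + (\<Sum>n. \<integral>\<^sup>+\<omega>. F \<omega> n \<partial>jl A)"
      unfolding F_def
      by (subst nn_integral_add) (auto simp: nn_integral_suminf A.emeasure_space_1)
    also have "(\<lambda>n. \<integral>\<^sup>+\<omega>. F \<omega> n \<partial>jl A) = (\<lambda>n. \<Sum>k<K. emeasure (jl A) (bad k n))"
      unfolding F_def by (intro ext, subst nn_integral_sum) auto
    finally show ?thesis .
  qed
  finally show ?thesis .
qed

end

section \<open>The procedure as a synchronous procedure, and what the error constraints say about
  one stream\<close>

lemma check_T_eq_enat_iff:
  "check_T K l u a b c d lam = enat n \<longleftrightarrow>
    1 \<le> n \<and> stop_cond K l u a b c d (\<lambda>k. lam k n) \<and> (\<forall>m\<in>{1..<n}. \<not> stop_cond K l u a b c d (\<lambda>k. lam k m))"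
  (is "?L \<longleftrightarrow> ?R")
proof
  let ?P = "\<lambda>n. 1 \<le> n \<and> stop_cond K l u a b c d (\<lambda>k. lam k n)"
  assume ?L
  then have ex: "\<exists>n\<ge>1. stop_cond K l u a b c d (\<lambda>k. lam k n)" and n: "n = (LEAST n. ?P n)"
    by (auto simp: check_T_def split: if_splits)
  have "?P n" unfolding n using ex by (rule LeastI_ex)
  moreover have "\<not> ?P m" if "m < n" for m
    using that unfolding n by (rule not_less_Least)
  ultimately show ?R by auto
next
  assume R: ?R
  then have "(LEAST n. 1 \<le> n \<and> stop_cond K l u a b c d (\<lambda>k. lam k n)) = n"
    by (intro Least_equality) (auto simp: not_less[symmetric])
  moreover have "\<exists>n\<ge>1. stop_cond K l u a b c d (\<lambda>k. lam k n)" using R by blast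
  ultimately show ?L unfolding check_T_def by simp
qed

lemma not_stop_cond_before_check_T:
  assumes "enat n < check_T K l u a b c d lam" "1 \<le> n"
  shows "\<not> stop_cond K l u a b c d (\<lambda>k. lam k n)"
proof (cases "check_T K l u a b c d lam")
  case (enat t)
  with assms show ?thesis by (auto simp: check_T_eq_enat_iff)
next
  case infinity
  with assms show ?thesis by (auto simp: check_T_def split: if_splits)
qed

context streams
begin

text \<open>This lets the procedure compete in the infimum. Stopping at \<open>n\<close> depends on
  ratios up to time \<open>n\<close>, and on that event a decision is a comparison of ratios at time
  \<open>n\<close>.\<close>

lemma sync_procedure_check:
  "sync_procedure K N (\<lambda>\<omega>. check_T K l u a b c d (\<lambda>k n. \<Lambda> k n \<omega>))
     (\<lambda>k \<omega>. check_D K l u a b c d (\<lambda>k n. \<Lambda> k n \<omega>) k)"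
proof -
  let ?T = "\<lambda>\<omega>. check_T K l u a b c d (\<lambda>k n. \<Lambda> k n \<omega>)"
  let ?D = "\<lambda>k \<omega>. check_D K l u a b c d (\<lambda>k n. \<Lambda> k n \<omega>) k"
  let ?sc = "\<lambda>n \<omega>. stop_cond K l u a b c d (\<lambda>k. \<Lambda> k n \<omega>)"
  have sc: "Measurable.pred (obs_filt K N n) (?sc m)" if "m \<le> n" for m n
    using that by (intro measurable_stop_cond measurable_jLLR_obs)
  have T: "Measurable.pred (obs_filt K N n) (\<lambda>\<omega>. ?T \<omega> = enat n)" for n
    unfolding check_T_eq_enat_iff using sc by (intro pred_intros_logic pred_intros_finite) auto
  have D: "Measurable.pred (obs_filt K N n) (\<lambda>\<omega>. ?T \<omega> = enat n \<and> ?D k \<omega>)" if k: "k < K" for k n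
  proof -
    have [measurable]: "j < K \<Longrightarrow> \<Lambda> j n \<in> borel_measurable (obs_filt K N n)" for j
      by (intro measurable_jLLR_obs) auto
    have [measurable]: "\<Lambda> k n \<in> borel_measurable (obs_filt K N n)"
      using k by measurable
    have [measurable]: "(\<lambda>\<omega>. n_declared K l u (\<lambda>j. \<Lambda> j n \<omega>)) \<in> obs_filt K N n \<rightarrow>\<^sub>M count_space UNIV"
      unfolding n_declared_def by measurable
    \<comment> \<open>The index of the order statistic is itself random, but it takes countably many
      values.\<close>
    have [measurable]: "(\<lambda>\<omega>. ord_stat K (\<lambda>j. \<Lambda> j n \<omega>) (n_declared K l u (\<lambda>j. \<Lambda> j n \<omega>))) \<in> borel_measurable (obs_filt K N n)"
      by (rule measurable_compose_countable[where f = "\<lambda>i \<omega>. ord_stat K (\<lambda>j. \<Lambda> j n \<omega>) i"]) measurable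
    have eq: "?T \<omega> = enat n \<and> ?D k \<omega> \<longleftrightarrow> ?T \<omega> = enat n \<and>
       ord_stat K (\<lambda>j. \<Lambda> j n \<omega>) (n_declared K l u (\<lambda>j. \<Lambda> j n \<omega>)) \<le> ereal (\<Lambda> k n \<omega>)" for \<omega>
      by (auto simp: check_D_def)
    have "Measurable.pred (obs_filt K N n)
        (\<lambda>\<omega>. ord_stat K (\<lambda>j. \<Lambda> j n \<omega>) (n_declared K l u (\<lambda>j. \<Lambda> j n \<omega>)) \<le> ereal (\<Lambda> k n \<omega>))"
      unfolding pred_def by (rule borel_measurable_le) measurable
    then show ?thesis unfolding eq by (intro pred_intros_logic T)
  qed
  have "?T \<omega> \<noteq> 0" for \<omega>
    using check_T_eq_enat_iff[of K l u a b c d "\<lambda>k n. \<Lambda> k n \<omega>" 0] by (simp add: zero_enat_def)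
  then show ?thesis
    using T D by (simp add: sync_procedure_def pred_def)
qed

context
  fixes T D \<alpha> \<beta> Hyp B
  assumes sync: "sync_procedure K N T D" and Delta: "in_Delta K P0 P1 \<alpha> \<beta> Hyp T D" and B: "B \<in> Hyp" "B \<subseteq> {..<K}"
begin

text \<open>Since \<open>measure\<close> is 0 on a set that is not measurable, the familywise bounds
  say something about a single stream only once measurability is known.\<close>

lemma sets_decision:
  assumes "k < K"
  shows "{\<omega> \<in> space (jl B). T \<omega> \<noteq> \<infinity> \<and> D k \<omega>} \<in> sets (jl B)"
    and "{\<omega> \<in> space (jl B). T \<omega> \<noteq> \<infinity> \<and> \<not> D k \<omega>} \<in> sets (jl B)"
proof -
  have T: "{\<omega> \<in> space (joint_space K N). T \<omega> = enat n} \<in> sets (jl B)"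
    and TD: "{\<omega> \<in> space (joint_space K N). T \<omega> = enat n \<and> D k \<omega>} \<in> sets (jl B)" for n
    using sync assms by (auto simp: sync_procedure_def sets_joint_law intro!: sets_obs_filt_joint)
  have "{\<omega> \<in> space (jl B). T \<omega> \<noteq> \<infinity> \<and> D k \<omega>}
      = (\<Union>n. {\<omega> \<in> space (joint_space K N). T \<omega> = enat n \<and> D k \<omega>})"
    by (auto simp: space_joint_law)
  with TD show "{\<omega> \<in> space (jl B). T \<omega> \<noteq> \<infinity> \<and> D k \<omega>} \<in> sets (jl B)" by auto
  have "{\<omega> \<in> space (jl B). T \<omega> \<noteq> \<infinity> \<and> \<not> D k \<omega>}
      = (\<Union>n. {\<omega> \<in> space (joint_space K N). T \<omega> = enat n} - {\<omega> \<in> space (joint_space K N). T \<omega> = enat n \<and> D k \<omega>})"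
    by (auto simp: space_joint_law)
  with T TD show "{\<omega> \<in> space (jl B). T \<omega> \<noteq> \<infinity> \<and> \<not> D k \<omega>} \<in> sets (jl B)" by auto
qed

text \<open>One wrong stream is already a familywise error. The lower bound uses the error
  constraints only through this and its counterpart \<open>false_negative_le\<close>.\<close>

lemma false_positive_le:
  assumes "j < K" "j \<notin> B"
  shows "measure (jl B) {\<omega> \<in> space (jl B). T \<omega> \<noteq> \<infinity> \<and> D j \<omega>} \<le> \<alpha>"
proof -
  interpret B: prob_space "jl B" by (rule prob_space_joint_law)
  have "{\<omega> \<in> space (jl B). T \<omega> \<noteq> \<infinity> \<and> (\<exists>j<K. j \<notin> B \<and> D j \<omega>)}
      = (\<Union>j\<in>{..<K} - B. {\<omega> \<in> space (jl B). T \<omega> \<noteq> \<infinity> \<and> D j \<omega>})" by auto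
  then have "{\<omega> \<in> space (jl B). T \<omega> \<noteq> \<infinity> \<and> (\<exists>j<K. j \<notin> B \<and> D j \<omega>)} \<in> sets (jl B)"
    using sets_decision(1) by auto
  then have "measure (jl B) {\<omega> \<in> space (jl B). T \<omega> \<noteq> \<infinity> \<and> D j \<omega>}
      \<le> measure (jl B) {\<omega> \<in> space (jl B). T \<omega> \<noteq> \<infinity> \<and> (\<exists>j<K. j \<notin> B \<and> D j \<omega>)}"
    using assms by (intro B.finite_measure_mono) auto
  also have "\<dots> \<le> \<alpha>" using Delta B(1) by (simp add: in_Delta_def)
  finally show ?thesis .
qed

lemma false_negative_le:
  assumes "i \<in> B"
  shows "measure (jl B) {\<omega> \<in> space (jl B). T \<omega> \<noteq> \<infinity> \<and> \<not> D i \<omega>} \<le> \<beta>"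
proof -
  interpret B: prob_space "jl B" by (rule prob_space_joint_law)
  have "finite B" using B(2) finite_subset by blast
  have eq: "{\<omega> \<in> space (jl B). T \<omega> \<noteq> \<infinity> \<and> (\<exists>i\<in>B. \<not> D i \<omega>)}
      = (\<Union>i\<in>B. {\<omega> \<in> space (jl B). T \<omega> \<noteq> \<infinity> \<and> \<not> D i \<omega>})" by auto
  have "{\<omega> \<in> space (jl B). T \<omega> \<noteq> \<infinity> \<and> (\<exists>i\<in>B. \<not> D i \<omega>)} \<in> sets (jl B)"
    unfolding eq by (intro sets.finite_UN sets_decision(2) \<open>finite B\<close>) (use B(2) in auto)
  then have "measure (jl B) {\<omega> \<in> space (jl B). T \<omega> \<noteq> \<infinity> \<and> \<not> D i \<omega>}
      \<le> measure (jl B) {\<omega> \<in> space (jl B). T \<omega> \<noteq> \<infinity> \<and> (\<exists>i\<in>B. \<not> D i \<omega>)}"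
    using assms by (intro B.finite_measure_mono) auto
  also have "\<dots> \<le> \<beta>" using Delta B(1) by (simp add: in_Delta_def)
  finally show ?thesis .
qed

end

end

section \<open>Growth rates of the log-likelihood ratios\<close>

locale drifting_streams = streams +
  fixes I J :: "nat \<Rightarrow> real"
  assumes limsup1: "\<And>k. k < K \<Longrightarrow>
        AE x in P1 k. limsup (\<lambda>n. ereal (LLR N (P0 k) (P1 k) n x / real n)) \<le> ereal (I k)"
    and limsup0: "\<And>k. k < K \<Longrightarrow>
        AE x in P0 k. limsup (\<lambda>n. ereal (- LLR N (P0 k) (P1 k) n x / real n)) \<le> ereal (J k)"
    and compl1: "\<And>k \<epsilon>. k < K \<Longrightarrow> 0 < \<epsilon> \<Longrightarrow>
        summable (\<lambda>n. measure (P1 k) {x \<in> space (P1 k).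
                    LLR N (P0 k) (P1 k) (Suc n) x / real (Suc n) \<le> I k - \<epsilon>})"
    and compl0: "\<And>k \<epsilon>. k < K \<Longrightarrow> 0 < \<epsilon> \<Longrightarrow>
        summable (\<lambda>n. measure (P0 k) {x \<in> space (P0 k).
                    - LLR N (P0 k) (P1 k) (Suc n) x / real (Suc n) \<le> J k - \<epsilon>})"
begin

lemma AE_joint_law:
  assumes "k < K" "AE x in (if k \<in> A then P1 k else P0 k). P x"
  shows "AE \<omega> in jl A. P (\<omega> k)"
  unfolding joint_law_def
  by (rule AE_PiM_component[where M = "\<lambda>k. if k \<in> A then P1 k else P0 k"]) (use assms prob_P in auto)

text \<open>The rate that stream k contributes to \<open>logratio A C\<close> under P_A: a removed
  signal enters with its own ratio, an added noise stream with minus its ratio, so \<open>I\<close>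
  and \<open>J\<close> both carry a plus sign.\<close>

definition drift :: "nat set \<Rightarrow> nat set \<Rightarrow> nat \<Rightarrow> real" where
  "drift A C k = (if k \<in> A - C then I k else if k \<in> C - A then J k else 0)"

lemma eventually_le_of_limsup:
  fixes f :: "nat \<Rightarrow> real"
  assumes "limsup (\<lambda>n. ereal (f n / real n)) \<le> ereal x" "0 < e"
  shows "\<forall>\<^sub>F n in sequentially. f n \<le> (x + e) * real n"
proof -
  have "limsup (\<lambda>n. ereal (f n / real n)) < ereal (x + e)"
    using assms by (auto intro: le_less_trans)
  from Limsup_lessD[OF this] eventually_gt_at_top[of 0] show ?thesis
    by eventually_elim (simp add: field_simps)
qed

lemma AE_logratio_le:
  assumes r: "(\<Sum>k<K. drift A C k) < r" and K: "0 < K"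
  shows "AE \<omega> in jl A. \<forall>\<^sub>F n in sequentially. logratio A C n \<omega> \<le> r * real n"
proof -
  \<comment> \<open>The slack between \<open>r\<close> and the total drift is shared equally among
    the K streams.\<close>
  define e where "e = (r - (\<Sum>k<K. drift A C k)) / real K"
  have e: "0 < e" using r K by (simp add: e_def)
  define t where "t k n \<omega> = (if k \<in> A then \<Lambda> k n \<omega> else 0) - (if k \<in> C then \<Lambda> k n \<omega> else 0)" for k n \<omega>
  have "AE \<omega> in jl A. \<forall>k\<in>{..<K}. \<forall>\<^sub>F n in sequentially. t k n \<omega> \<le> (drift A C k + e) * real n"
  proof (intro AE_finite_allI)
    fix k assume "k \<in> {..<K}"
    then have k: "k < K" by simp
    consider "k \<in> A - C" | "k \<in> C - A" | "k \<in> A \<longleftrightarrow> k \<in> C" by blast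
    then show "AE \<omega> in jl A. \<forall>\<^sub>F n in sequentially. t k n \<omega> \<le> (drift A C k + e) * real n"
    proof cases
      case 1
      then have "AE \<omega> in jl A. limsup (\<lambda>n. ereal (LLR N (P0 k) (P1 k) n (\<omega> k) / real n)) \<le> ereal (I k)"
        using limsup1[OF k] by (intro AE_joint_law[OF k]) simp
      then show ?thesis
      proof eventually_elim
        case (elim \<omega>)
        from eventually_le_of_limsup[OF this e] show ?case
          using 1 by (simp add: t_def drift_def jLLR_def)
      qed
    next
      case 2
      then have "AE \<omega> in jl A. limsup (\<lambda>n. ereal (- LLR N (P0 k) (P1 k) n (\<omega> k) / real n)) \<le> ereal (J k)"
        using limsup0[OF k] by (intro AE_joint_law[OF k]) simp
      then show ?thesis
      proof eventually_elim
        case (elim \<omega>)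
        from eventually_le_of_limsup[OF this e] show ?case
          using 2 by (simp add: t_def drift_def jLLR_def)
      qed
    next
      case 3
      then show ?thesis using e by (auto simp: t_def drift_def)
    qed
  qed simp
  then show ?thesis
  proof eventually_elim
    case (elim \<omega>)
    then have "\<forall>\<^sub>F n in sequentially. \<forall>k\<in>{..<K}. t k n \<omega> \<le> (drift A C k + e) * real n"
      by (intro eventually_ball_finite) auto
    then show ?case
    proof eventually_elim
      case (elim n)
      have "logratio A C n \<omega> \<le> (\<Sum>k<K. (drift A C k + e) * real n)"
        unfolding logratio_def using elim by (intro sum_mono) (simp add: t_def)
      also have "\<dots> = ((\<Sum>k<K. drift A C k) + real K * e) * real n"
        by (simp add: sum.distrib flip: sum_distrib_right)
      also have "real K * e = r - (\<Sum>k<K. drift A C k)" using K by (simp add: e_def)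
      finally show ?case by simp
    qed
  qed
qed

text \<open>The tolerance is proportional to the rate, so that one factor 1 - \<eta> serves all
  streams; index \<open>n\<close> is time n + 1, as in the summability assumptions.\<close>

definition slow :: "real \<Rightarrow> nat set \<Rightarrow> nat \<Rightarrow> nat \<Rightarrow> (nat \<Rightarrow> nat \<Rightarrow> 'a) set" where
  "slow \<eta> A k n = {\<omega> \<in> space (jl A).
     if k \<in> A then \<Lambda> k (Suc n) \<omega> / real (Suc n) \<le> I k - \<eta> * I k
     else - \<Lambda> k (Suc n) \<omega> / real (Suc n) \<le> J k - \<eta> * J k}"

lemma sets_slow [measurable]: "k < K \<Longrightarrow> slow \<eta> A k n \<in> sets (jl A)"
proof -
  assume k: "k < K"
  have [measurable]: "\<Lambda> k (Suc n) \<in> borel_measurable (jl A)"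
    using measurable_jLLR[OF k] sets_joint_law by (simp cong: measurable_cong_sets)
  show ?thesis unfolding slow_def by measurable
qed

lemma measure_stream:
  assumes k: "k < K" and P: "Measurable.pred (seq_space N) P"
  shows "measure (jl A) {\<omega> \<in> space (jl A). P (\<omega> k)}
    = measure (if k \<in> A then P1 k else P0 k) {x \<in> space (if k \<in> A then P1 k else P0 k). P x}"
proof -
  have comp: "(\<lambda>\<omega>. \<omega> k) \<in> jl A \<rightarrow>\<^sub>M seq_space N"
    using measurable_stream[OF k] sets_joint_law by (simp cong: measurable_cong_sets)
  have sp: "space (if k \<in> A then P1 k else P0 k) = space (seq_space N)"
    by (rule sets_eq_imp_space_eq[OF sets_P[OF k]])
  have "measure (distr (jl A) (seq_space N) (\<lambda>\<omega>. \<omega> k)) {x \<in> space (seq_space N). P x}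
      = measure (jl A) ((\<lambda>\<omega>. \<omega> k) -` {x \<in> space (seq_space N). P x} \<inter> space (jl A))"
    using P by (intro measure_distr[OF comp]) (simp add: pred_def)
  also have "(\<lambda>\<omega>. \<omega> k) -` {x \<in> space (seq_space N). P x} \<inter> space (jl A) = {\<omega> \<in> space (jl A). P (\<omega> k)}"
    using measurable_space[OF comp] by blast
  finally show ?thesis
    unfolding sp distr_stream[OF k] by (rule sym)
qed

text \<open>The sum is the expected number of lagging pairs of a time and a stream. Complete
  convergence, with tolerance \<eta> I or \<eta> J, makes the series of each stream
  converge.\<close>

lemma slow_finite:
  assumes IJ: "\<And>k. k < K \<Longrightarrow> 0 < I k \<and> 0 < J k" and \<eta>: "0 < \<eta>"
  shows "(\<Sum>n. \<Sum>k<K. emeasure (jl A) (slow \<eta> A k n)) < \<infinity>"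
proof -
  interpret A: prob_space "jl A" by (rule prob_space_joint_law)
  have "summable (\<lambda>n. measure (jl A) (slow \<eta> A k n))" if k: "k < K" for k
  proof -
    note law = measure_stream[OF k, of _ A]
    note [measurable] = measurable_LLR[OF k]
    show ?thesis
    proof (cases "k \<in> A")
      case True
      have "measure (jl A) (slow \<eta> A k n) = measure (P1 k) {x \<in> space (P1 k).
                    LLR N (P0 k) (P1 k) (Suc n) x / real (Suc n) \<le> I k - \<eta> * I k}" for n
    proof -
      have "Measurable.pred (seq_space N) (\<lambda>x. LLR N (P0 k) (P1 k) (Suc n) x / real (Suc n) \<le> I k - \<eta> * I k)"
        by measurable
      from law[OF this] True show ?thesis by (simp only: slow_def jLLR_def if_True)
    qed
      then show ?thesis using compl1[OF k mult_pos_pos[OF \<eta>]] IJ[OF k] by (simp only:)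
    next
      case False
      have "measure (jl A) (slow \<eta> A k n) = measure (P0 k) {x \<in> space (P0 k).
                    - LLR N (P0 k) (P1 k) (Suc n) x / real (Suc n) \<le> J k - \<eta> * J k}" for n
    proof -
      have "Measurable.pred (seq_space N) (\<lambda>x. - LLR N (P0 k) (P1 k) (Suc n) x / real (Suc n) \<le> J k - \<eta> * J k)"
        by measurable
      from law[OF this] False show ?thesis by (simp only: slow_def jLLR_def if_False)
    qed
      then show ?thesis using compl0[OF k mult_pos_pos[OF \<eta>]] IJ[OF k] by (simp only:)
    qed
  qed
  then have "summable (\<lambda>n. \<Sum>k<K. measure (jl A) (slow \<eta> A k n))"
    by (intro summable_sum) auto
  then have "(\<Sum>n. ennreal (\<Sum>k<K. measure (jl A) (slow \<eta> A k n))) < \<infinity>"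
    by (subst suminf_ennreal2) (auto intro: sum_nonneg)
  then show ?thesis
    by (simp add: A.emeasure_eq_measure sum_ennreal)
qed

end

section \<open>Matching lower and upper bounds for a fixed signal set\<close>

locale sparse_detection = drifting_streams K N P0 P1 I J + signal_set K l u I J A
  for K N P0 P1 I J l u A
begin

abbreviation "procedure \<alpha> \<beta> T D \<equiv> sync_procedure K N T D \<and> in_Delta K P0 P1 \<alpha> \<beta> (Pi_lu K l u) T D"

text \<open>The decision on stream k tells A from C. If k is a signal only under A, declaring it is
  a false positive under C, hence |log \<alpha>|; if only under C, not declaring it is a miss under
  C, hence |log \<beta>|. The other error level only has to be below a constant.\<close>

lemma exp_time_lower_separated:
  assumes C: "C \<in> Pi_lu K l u" and R: "0 < R" "(\<Sum>k<K. drift A C k) = R" and \<delta>: "0 < \<delta>" "\<delta> < 1"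
  shows "k \<in> A - C \<Longrightarrow> \<forall>\<^sub>F p in at_right 0 \<times>\<^sub>F at_right 0. \<forall>T D. procedure (fst p) (snd p) T D \<longrightarrow>
      ennreal ((1 - \<delta>) * (1 / R * \<bar>ln (fst p)\<bar>)) \<le> exp_time K P0 P1 A T" (is "_ \<Longrightarrow> ?thesis1")
    and "k \<in> C - A \<Longrightarrow> \<forall>\<^sub>F p in at_right 0 \<times>\<^sub>F at_right 0. \<forall>T D. procedure (fst p) (snd p) T D \<longrightarrow>
      ennreal ((1 - \<delta>) * (1 / R * \<bar>ln (snd p)\<bar>)) \<le> exp_time K P0 P1 A T" (is "_ \<Longrightarrow> ?thesis2")
proof -
  have C_sub: "C \<subseteq> {..<K}" using C by (simp add: Pi_lu_def)
  have K0: "0 < K" using lu by simp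
  have ev: "\<forall>r>R. AE \<omega> in jl A. \<forall>\<^sub>F n in sequentially. logratio A C n \<omega> \<le> r * real n"
    using R K0 by (auto intro: AE_logratio_le)
  note lower = exp_time_lower_bound[OF R(1) ev \<delta>]
  have small: "\<forall>\<^sub>F \<epsilon> :: real in at_right 0. \<epsilon> < \<delta> / 6"
    using \<delta> by (intro order_tendstoD(2)[OF tendsto_ident_at]) auto
  \<comment> \<open>What holds eventually in one error level holds eventually in the product filter,
    whatever the other level does.\<close>
  have fst: "eventually P (at_right 0) \<Longrightarrow> \<forall>\<^sub>F p in at_right 0 \<times>\<^sub>F at_right 0. P (fst p)" for P :: "real \<Rightarrow> bool"
    by (erule eventually_compose_filterlim[OF _ filterlim_fst])
  have snd: "eventually P (at_right 0) \<Longrightarrow> \<forall>\<^sub>F p in at_right 0 \<times>\<^sub>F at_right 0. P (snd p)" for P :: "real \<Rightarrow> bool"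
    by (erule eventually_compose_filterlim[OF _ filterlim_snd])
  show ?thesis1 if k: "k \<in> A - C"
    using fst[OF lower] snd[OF small]
  proof eventually_elim
    case (elim p)
    show ?case
    proof (intro allI impI)
      fix T D assume "procedure (fst p) (snd p) T D"
      then have sync: "sync_procedure K N T D" and Delta: "in_Delta K P0 P1 (fst p) (snd p) (Pi_lu K l u) T D"
        by auto
      have k': "k < K" using k A_sub by auto
      have "measure (jl A) {\<omega> \<in> space (jl A). T \<omega> \<noteq> \<infinity> \<and> \<not> D k \<omega>} \<le> snd p"
        using false_negative_le[OF sync Delta A A_sub] k by blast
      moreover have "measure (jl C) {\<omega> \<in> space (jl C). T \<omega> \<noteq> \<infinity> \<and> D k \<omega>} \<le> fst p"
        using false_positive_le[OF sync Delta C C_sub k'] k by blast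
      ultimately have "ennreal ((1 - \<delta>) * (\<bar>ln (fst p)\<bar> / R)) \<le> exp_time K P0 P1 A T"
        using sync k' elim(2)
        by (intro elim(1)[rule_format, of "snd p" T "D k"]) (auto simp: sync_procedure_def)
      then show "ennreal ((1 - \<delta>) * (1 / R * \<bar>ln (fst p)\<bar>)) \<le> exp_time K P0 P1 A T"
        by simp
    qed
  qed
  show ?thesis2 if k: "k \<in> C - A"
    using snd[OF lower] fst[OF small]
  proof eventually_elim
    case (elim p)
    show ?case
    proof (intro allI impI)
      fix T D assume "procedure (fst p) (snd p) T D"
      then have sync: "sync_procedure K N T D" and Delta: "in_Delta K P0 P1 (fst p) (snd p) (Pi_lu K l u) T D"
        by auto
      have k': "k < K" using k C_sub by auto
      have "measure (jl A) {\<omega> \<in> space (jl A). T \<omega> \<noteq> \<infinity> \<and> \<not> \<not> D k \<omega>} \<le> fst p"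
        using false_positive_le[OF sync Delta A A_sub k'] k by simp
      moreover have "measure (jl C) {\<omega> \<in> space (jl C). T \<omega> \<noteq> \<infinity> \<and> \<not> D k \<omega>} \<le> snd p"
        using false_negative_le[OF sync Delta C C_sub] k by blast
      moreover have "{\<omega> \<in> space (joint_space K N). T \<omega> = enat n \<and> \<not> D k \<omega>} \<in> sets (obs_filt K N n)" for n
      proof -
        have "{\<omega> \<in> space (joint_space K N). T \<omega> = enat n \<and> \<not> D k \<omega>}
          = {\<omega> \<in> space (joint_space K N). T \<omega> = enat n} - {\<omega> \<in> space (joint_space K N). T \<omega> = enat n \<and> D k \<omega>}"
          by auto
        then show ?thesis using sync k' by (simp add: sync_procedure_def sets.Diff)
      qed
      ultimately have "ennreal ((1 - \<delta>) * (\<bar>ln (snd p)\<bar> / R)) \<le> exp_time K P0 P1 A T"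
        using sync k' elim(2)
        by (intro elim(1)[rule_format, of "fst p" T "\<lambda>\<omega>. \<not> D k \<omega>"]) (auto simp: sync_procedure_def)
      then show "ennreal ((1 - \<delta>) * (1 / R * \<bar>ln (snd p)\<bar>)) \<le> exp_time K P0 P1 A T"
        by simp
    qed
  qed
qed

lemma sum_drift_remove:
  assumes "i \<in> A"
  shows "(\<Sum>k<K. drift A (A - {i}) k) = I i"
proof -
  have "(\<Sum>k<K. drift A (A - {i}) k) = (\<Sum>k<K. if k = i then I k else 0)"
    using assms by (intro sum.cong) (auto simp: drift_def)
  then show ?thesis using assms A_sub by auto
qed

lemma sum_drift_insert:
  assumes "j < K" "j \<notin> A"
  shows "(\<Sum>k<K. drift A (insert j A) k) = J j"
proof -
  have "(\<Sum>k<K. drift A (insert j A) k) = (\<Sum>k<K. if k = j then J k else 0)"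
    using assms by (intro sum.cong) (auto simp: drift_def)
  then show ?thesis using assms by simp
qed

lemma sum_drift_swap:
  assumes "i \<in> A" "j < K" "j \<notin> A"
  shows "(\<Sum>k<K. drift A (insert j (A - {i})) k) = I i + J j"
proof -
  have i: "i < K" "i \<noteq> j" using assms A_sub by auto
  have "(\<Sum>k<K. drift A (insert j (A - {i})) k) = (\<Sum>k<K. (if k = i then I k else 0) + (if k = j then J k else 0))"
    using assms i by (intro sum.cong) (auto simp: drift_def)
  then show ?thesis
    using assms i by (simp add: sum.distrib)
qed

lemma obtain_IA: assumes "A \<noteq> {}" obtains i where "i \<in> A" "I i = IA"
proof -
  have "IA \<in> I ` A" using assms by (intro Min_in) auto
  then show ?thesis using that by auto
qed

lemma obtain_JA: assumes "{..<K} - A \<noteq> {}" obtains j where "j < K" "j \<notin> A" "J j = JA"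
proof -
  have "JA \<in> J ` ({..<K} - A)" using assms by (intro Min_in) auto
  then show ?thesis using that by auto
qed

text \<open>A swap keeps the cardinality and so is admissible even when |A| is extremal, at the
  price of an alternative that is separated faster, at rate \<open>I i + J j\<close>.\<close>

lemma swap_in_Pi:
  assumes "i \<in> A" "j < K" "j \<notin> A"
  shows "insert j (A - {i}) \<in> Pi_lu K l u"
proof -
  have "card (insert j (A - {i})) = card A"
    using assms card_gt_0_iff[of A] by auto
  then show ?thesis using A assms by (auto simp: Pi_lu_def)
qed

text \<open>To bring in \<alpha>, the alternative must lack a signal i of A, so that declaring i
  becomes a false positive. If |A| > l it is enough to remove i; if |A| = l a noise stream has to
  take its place.\<close>

lemma exp_time_lower1:
  assumes \<delta>: "0 < \<delta>" "\<delta> < 1"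
  shows "\<forall>\<^sub>F p in at_right 0 \<times>\<^sub>F at_right 0. \<forall>T D. procedure (fst p) (snd p) T D \<longrightarrow>
      ennreal ((1 - \<delta>) * (w1 * \<bar>ln (fst p)\<bar>)) \<le> exp_time K P0 P1 A T"
proof (cases "A = {}")
  case True
  have "w1 = 0" unfolding w1_def using True by simp
  then show ?thesis by simp
next
  case False
  then obtain i where i: "i \<in> A" "I i = IA" by (rule obtain_IA)
  show ?thesis
  proof (cases "card A = l")
    case True
    then obtain j where j: "j < K" "j \<notin> A" "J j = JA" using compl_nonempty by (blast intro: obtain_JA)
    have w: "w1 = 1 / (I i + J j)" using False True i j by (simp add: w1_def)
    have R: "0 < I i + J j" using denom1_pos[OF False] True i j by simp
    show ?thesis
      unfolding w using i j
      by (intro exp_time_lower_separated(1)[OF swap_in_Pi R sum_drift_swap \<delta>, where k = i]) auto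
  next
    case card: False
    have w: "w1 = 1 / I i" using False card i by (simp add: w1_def)
    have R: "0 < I i" using denom1_pos[OF False] card i by simp
    have "card (A - {i}) = card A - 1" using i by simp
    then have C: "A - {i} \<in> Pi_lu K l u"
      using A card card_ge card_le A_sub by (auto simp: Pi_lu_def)
    show ?thesis
      unfolding w using i
      by (intro exp_time_lower_separated(1)[OF C R sum_drift_remove \<delta>, where k = i]) auto
  qed
qed

text \<open>The mirror case: the alternative has an additional signal j, and if |A| = u another
  signal has to be given up for it.\<close>

lemma exp_time_lower2:
  assumes \<delta>: "0 < \<delta>" "\<delta> < 1"
  shows "\<forall>\<^sub>F p in at_right 0 \<times>\<^sub>F at_right 0. \<forall>T D. procedure (fst p) (snd p) T D \<longrightarrow>
      ennreal ((1 - \<delta>) * (w2 * \<bar>ln (snd p)\<bar>)) \<le> exp_time K P0 P1 A T"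
proof (cases "{..<K} - A = {}")
  case True
  have "w2 = 0" unfolding w2_def using True by simp
  then show ?thesis by simp
next
  case False
  then obtain j where j: "j < K" "j \<notin> A" "J j = JA" by (rule obtain_JA)
  show ?thesis
  proof (cases "card A = u")
    case True
    then obtain i where i: "i \<in> A" "I i = IA" using nonempty by (blast intro: obtain_IA)
    have w: "w2 = 1 / (I i + J j)" using False True i j by (simp add: w2_def add.commute)
    have R: "0 < I i + J j" using denom2_pos[OF False] True i j by simp
    show ?thesis
      unfolding w using i j
      by (intro exp_time_lower_separated(2)[OF swap_in_Pi R sum_drift_swap \<delta>, where k = j]) auto
  next
    case card: False
    have w: "w2 = 1 / J j" using False card j by (simp add: w2_def)
    have R: "0 < J j" using denom2_pos[OF False] card j by simp
    have "card (insert j A) = card A + 1" using j by simp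
    then have C: "insert j A \<in> Pi_lu K l u"
      using A card card_ge card_le A_sub j by (auto simp: Pi_lu_def)
    show ?thesis
      unfolding w using j
      by (intro exp_time_lower_separated(2)[OF C R sum_drift_insert \<delta>, where k = j]) auto
  qed
qed

lemma exp_time_lower:
  assumes \<delta>: "0 < \<delta>" "\<delta> < 1"
  shows "\<forall>\<^sub>F p in at_right 0 \<times>\<^sub>F at_right 0. \<forall>T D. procedure (fst p) (snd p) T D \<longrightarrow>
      ennreal ((1 - \<delta>) * opt_rate K I J l u A (fst p) (snd p)) \<le> exp_time K P0 P1 A T"
  using exp_time_lower1[OF \<delta>] exp_time_lower2[OF \<delta>]
  by eventually_elim (simp add: opt_rate_eq max_def)

text \<open>\<open>M\<close> is obtained before the thresholds are chosen, so it stays fixed while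
  they grow.\<close>

lemma exp_time_check_le:
  assumes \<eta>: "0 < \<eta>" "\<eta> < 1"
  obtains M where "0 \<le> M"
    "\<And>a b c d. 0 < a \<Longrightarrow> 0 < b \<Longrightarrow>
       exp_time K P0 P1 A (\<lambda>\<omega>. check_T K l u a b c d (\<lambda>k n. \<Lambda> k n \<omega>))
         \<le> ennreal (max (w1 * max a c) (w2 * max b d) / (1 - \<eta>) + M)"
proof -
  define S where "S = (\<Sum>n. \<Sum>k<K. emeasure (jl A) (slow \<eta> A k n))"
  \<comment> \<open>Rounding \<open>q\<close> up costs at most 1, and the general bound adds another
    1 to \<open>n0\<close>.\<close>
  define M where "M = 2 + enn2real S"
  have S: "S = ennreal (enn2real S)"
    using slow_finite[OF IJ_pos \<eta>(1), of A] by (simp add: S_def)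
  have "exp_time K P0 P1 A (\<lambda>\<omega>. check_T K l u a b c d (\<lambda>k n. \<Lambda> k n \<omega>))
         \<le> ennreal (max (w1 * max a c) (w2 * max b d) / (1 - \<eta>) + M)" if ab: "0 < a" "0 < b" for a b c d
  proof -
    define q where "q = max (w1 * max a c) (w2 * max b d) / (1 - \<eta>)"
    have q0: "0 \<le> q"
      unfolding q_def using ab w1_nonneg \<eta> by (intro divide_nonneg_nonneg) (auto simp: le_max_iff_disj)
    define n0 where "n0 = nat \<lceil>q\<rceil>"
    have "exp_time K P0 P1 A (\<lambda>\<omega>. check_T K l u a b c d (\<lambda>k n. \<Lambda> k n \<omega>)) \<le> of_nat (n0 + 1) + S"
      unfolding S_def
    proof (rule exp_time_upper_bound)
      fix \<omega> n
      assume w: "\<omega> \<in> space (jl A)" and n: "n0 \<le> n"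
        and T: "enat (Suc n) < check_T K l u a b c d (\<lambda>k n. \<Lambda> k n \<omega>)"
      show "\<exists>k<K. \<omega> \<in> slow \<eta> A k n"
      proof (rule ccontr)
        assume "\<not> ?thesis"
        then have fast: "\<omega> \<notin> slow \<eta> A k n" if "k < K" for k using that by blast
        \<comment> \<open>At time n + 1 a stream that is not slow has moved by more than
          \<open>s\<close> times its rate in the right direction.\<close>
        define s where "s = (1 - \<eta>) * real (Suc n)"
        have "q \<le> real (Suc n)" using n q0 by (simp add: n0_def nat_le_iff ceiling_le_iff)
        then have "max (w1 * max a c) (w2 * max b d) \<le> s"
          using \<eta> by (simp add: q_def s_def divide_le_eq mult.commute)
        moreover have "0 < s" using \<eta> by (simp add: s_def)
        moreover have "s * I i < \<Lambda> i (Suc n) \<omega>" if "i \<in> A" for i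
        proof -
          have "i < K" using that A_sub by auto
          from fast[OF this] that w show ?thesis
            by (simp add: slow_def s_def not_le field_simps)
        qed
        moreover have "s * J j < - \<Lambda> j (Suc n) \<omega>" if "j < K" "j \<notin> A" for j
          using fast[OF that(1)] that w by (simp add: slow_def s_def not_le field_simps)
        ultimately have "stop_cond K l u a b c d (\<lambda>k. \<Lambda> k (Suc n) \<omega>)"
          by (intro stop_cond_of_drift[of s]) auto
        then show False using not_stop_cond_before_check_T[OF T] by simp
      qed
    qed simp
    also have "of_nat (n0 + 1) + S = ennreal (real (n0 + 1) + enn2real S)"
      by (subst S) (simp add: ennreal_of_nat_eq_real_of_nat flip: ennreal_plus)
    also have "\<dots> \<le> ennreal (q + M)"
      using q0 by (intro ennreal_leI) (simp add: n0_def M_def, linarith)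
    finally show ?thesis by (simp add: q_def)
  qed
  moreover have "0 \<le> M" by (simp add: M_def)
  ultimately show ?thesis using that by blast
qed

lemma opt_rate_at_top:
  "filterlim (\<lambda>p. opt_rate K I J l u A (fst p) (snd p)) at_top (at_right 0 \<times>\<^sub>F at_right 0)"
proof -
  note ln = filterlim_abs_ln_at_right_0
  from w_pos show ?thesis
  proof
    assume "0 < w1"
    then have "filterlim (\<lambda>p. w1 * \<bar>ln (fst p)\<bar>) at_top (at_right 0 \<times>\<^sub>F at_right 0)"
      by (intro filterlim_tendsto_pos_mult_at_top[OF tendsto_const] filterlim_compose[OF ln filterlim_fst])
    then show ?thesis
      by (rule filterlim_at_top_mono) (simp add: opt_rate_eq)
  next
    assume "0 < w2"
    then have "filterlim (\<lambda>p. w2 * \<bar>ln (snd p)\<bar>) at_top (at_right 0 \<times>\<^sub>F at_right 0)"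
      by (intro filterlim_tendsto_pos_mult_at_top[OF tendsto_const] filterlim_compose[OF ln filterlim_snd])
    then show ?thesis
      by (rule filterlim_at_top_mono) (simp add: opt_rate_eq)
  qed
qed

lemma exp_time_check_upper:
  fixes a b c d :: "real \<times> real \<Rightarrow> real"
  assumes pos: "\<forall>\<^sub>F p in at_right 0 \<times>\<^sub>F at_right 0. 0 < a p \<and> 0 < b p"
    and asym: "((\<lambda>p. a p / \<bar>ln (fst p)\<bar>) \<longlongrightarrow> 1) (at_right 0 \<times>\<^sub>F at_right 0)"
      "((\<lambda>p. c p / \<bar>ln (fst p)\<bar>) \<longlongrightarrow> 1) (at_right 0 \<times>\<^sub>F at_right 0)"
      "((\<lambda>p. b p / \<bar>ln (snd p)\<bar>) \<longlongrightarrow> 1) (at_right 0 \<times>\<^sub>F at_right 0)"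
      "((\<lambda>p. d p / \<bar>ln (snd p)\<bar>) \<longlongrightarrow> 1) (at_right 0 \<times>\<^sub>F at_right 0)"
    and \<delta>: "0 < \<delta>" "\<delta> < 1"
  shows "\<forall>\<^sub>F p in at_right 0 \<times>\<^sub>F at_right 0.
    exp_time K P0 P1 A (\<lambda>\<omega>. check_T K l u (a p) (b p) (c p) (d p) (\<lambda>k n. \<Lambda> k n \<omega>))
      \<le> ennreal ((1 + \<delta>) * opt_rate K I J l u A (fst p) (snd p))"
proof -
  define F :: "(real \<times> real) filter" where "F = at_right 0 \<times>\<^sub>F at_right 0"
  define q where "q p = opt_rate K I J l u A (fst p) (snd p)" for p
  \<comment> \<open>The thresholds exceed their targets by a factor below 1 + \<eta> and the slowed
    drift costs 1 / (1 - \<eta>); together at most 1 + 4 \<eta>. The fifth \<eta> absorbs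
    \<open>M\<close>.\<close>
  define \<eta> where "\<eta> = \<delta> / 5"
  have \<eta>: "0 < \<eta>" "\<eta> < 1" "\<eta> \<le> 1 / 2" using \<delta> by (auto simp: \<eta>_def)
  obtain M where M: "0 \<le> M"
    and le: "\<And>a b c d. 0 < a \<Longrightarrow> 0 < b \<Longrightarrow>
       exp_time K P0 P1 A (\<lambda>\<omega>. check_T K l u a b c d (\<lambda>k n. \<Lambda> k n \<omega>))
         \<le> ennreal (max (w1 * max a c) (w2 * max b d) / (1 - \<eta>) + M)"
    using exp_time_check_le[OF \<eta>(1,2)] by blast
  have qtop: "filterlim q at_top F" using opt_rate_at_top by (simp add: q_def[abs_def] F_def)
  have "\<forall>\<^sub>F p in F. M / \<eta> < q p" using qtop by (simp add: filterlim_at_top_dense)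
  moreover have "\<forall>\<^sub>F p in F. fst p \<in> {0<..<1} \<and> snd p \<in> {0<..<1}"
    unfolding F_def
    by (intro eventually_conj eventually_compose_filterlim[OF _ filterlim_fst]
          eventually_compose_filterlim[OF _ filterlim_snd] eventually_at_right_real) auto
  moreover have "\<forall>\<^sub>F p in F. a p / \<bar>ln (fst p)\<bar> < 1 + \<eta>" "\<forall>\<^sub>F p in F. c p / \<bar>ln (fst p)\<bar> < 1 + \<eta>"
    "\<forall>\<^sub>F p in F. b p / \<bar>ln (snd p)\<bar> < 1 + \<eta>" "\<forall>\<^sub>F p in F. d p / \<bar>ln (snd p)\<bar> < 1 + \<eta>"
    unfolding F_def using \<eta> by (auto intro: order_tendstoD asym)
  ultimately have "\<forall>\<^sub>F p in F. exp_time K P0 P1 A (\<lambda>\<omega>. check_T K l u (a p) (b p) (c p) (d p) (\<lambda>k n. \<Lambda> k n \<omega>))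
      \<le> ennreal ((1 + \<delta>) * q p)"
    using pos[folded F_def]
  proof eventually_elim
    case (elim p)
    have ln: "0 < \<bar>ln (fst p)\<bar>" "0 < \<bar>ln (snd p)\<bar>" using elim(2) by auto
    have q0: "0 < q p" using elim(1) M \<eta> by (meson divide_nonneg_pos le_less_trans)
    have "max (a p) (c p) \<le> (1 + \<eta>) * \<bar>ln (fst p)\<bar>" "max (b p) (d p) \<le> (1 + \<eta>) * \<bar>ln (snd p)\<bar>"
      using elim(3-6) ln by (simp_all add: pos_divide_less_eq)
    then have "w1 * max (a p) (c p) \<le> w1 * ((1 + \<eta>) * \<bar>ln (fst p)\<bar>)"
      "w2 * max (b p) (d p) \<le> w2 * ((1 + \<eta>) * \<bar>ln (snd p)\<bar>)"
      using w1_nonneg w2_nonneg by (simp_all only: mult_left_mono)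
    moreover have "(1 + \<eta>) * (w1 * \<bar>ln (fst p)\<bar>) \<le> (1 + \<eta>) * q p"
      "(1 + \<eta>) * (w2 * \<bar>ln (snd p)\<bar>) \<le> (1 + \<eta>) * q p"
      using \<eta> by (auto simp: q_def opt_rate_eq intro!: mult_left_mono)
    ultimately have "max (w1 * max (a p) (c p)) (w2 * max (b p) (d p)) \<le> (1 + \<eta>) * q p"
      by (simp add: mult.left_commute)
    then have "max (w1 * max (a p) (c p)) (w2 * max (b p) (d p)) / (1 - \<eta>) \<le> (1 + \<eta>) * q p / (1 - \<eta>)"
      using \<eta> by (intro divide_right_mono) auto
    also have "\<dots> = (1 + \<eta>) / (1 - \<eta>) * q p" by simp
    also have "\<dots> \<le> (1 + 4 * \<eta>) * q p"
    proof (intro mult_right_mono)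
      \<comment> \<open>Multiplied out, the claim is 4 \<eta> (1/2 - \<eta>) \<ge> 0.\<close>
      have "0 \<le> \<eta> * (1 / 2 - \<eta>)" using \<eta> by simp
      then show "(1 + \<eta>) / (1 - \<eta>) \<le> 1 + 4 * \<eta>"
        using \<eta> by (simp add: pos_divide_le_eq algebra_simps)
    qed (use q0 in simp)
    finally have "max (w1 * max (a p) (c p)) (w2 * max (b p) (d p)) / (1 - \<eta>) \<le> (1 + 4 * \<eta>) * q p" .
    moreover have "M < \<eta> * q p" using elim(1) \<eta> by (simp add: pos_divide_less_eq mult.commute)
    moreover have "(1 + \<delta>) * q p = (1 + 4 * \<eta>) * q p + \<eta> * q p"
      by (simp add: \<eta>_def algebra_simps)
    ultimately have "max (w1 * max (a p) (c p)) (w2 * max (b p) (d p)) / (1 - \<eta>) + M \<le> (1 + \<delta>) * q p"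
      by linarith
    then show ?case
      using le[of "a p" "b p" "c p" "d p"] elim(7) by (meson ennreal_leI order_trans)
  qed
  then show ?thesis by (simp add: F_def q_def)
qed

end

section \<open>From two-sided bounds to asymptotic equivalence\<close>

lemma ratio_tendsto_1:
  fixes E :: "'b \<Rightarrow> ennreal" and q :: "'b \<Rightarrow> real"
  assumes q: "filterlim q at_top F"
    and lo: "\<And>\<delta>. 0 < \<delta> \<Longrightarrow> \<delta> < 1 \<Longrightarrow> \<forall>\<^sub>F p in F. ennreal ((1 - \<delta>) * q p) \<le> E p"
    and up: "\<And>\<delta>. 0 < \<delta> \<Longrightarrow> \<delta> < 1 \<Longrightarrow> \<forall>\<^sub>F p in F. E p \<le> ennreal ((1 + \<delta>) * q p)"
  shows "\<forall>\<^sub>F p in F. E p < \<infinity>" and "((\<lambda>p. enn2real (E p) / q p) \<longlongrightarrow> 1) F"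
proof -
  show "\<forall>\<^sub>F p in F. E p < \<infinity>"
    using up[of "1 / 2"] by (rule eventually_mono) (auto intro: le_less_trans)
  have q0: "\<forall>\<^sub>F p in F. 0 < q p" using q by (simp add: filterlim_at_top_dense)
  show "((\<lambda>p. enn2real (E p) / q p) \<longlongrightarrow> 1) F"
  proof (rule tendstoI)
    fix e :: real assume e: "0 < e"
    define \<delta> where "\<delta> = min (1 / 2) (e / 2)"
    have \<delta>: "0 < \<delta>" "\<delta> < 1" "\<delta> < e" using e by (auto simp: \<delta>_def)
    from lo[OF \<delta>(1,2)] up[OF \<delta>(1,2)] q0
    show "\<forall>\<^sub>F p in F. dist (enn2real (E p) / q p) 1 < e"
    proof eventually_elim
      case (elim p)
      \<comment> \<open>The upper bound excludes \<infinity>, where \<open>enn2real\<close> would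
        return 0.\<close>
      have "E p \<noteq> \<top>" using elim(2) by (auto simp: top_unique)
      then obtain r where r: "0 \<le> r" "E p = ennreal r" by (cases "E p") auto
      have "(1 - \<delta>) * q p \<le> r" "r \<le> (1 + \<delta>) * q p"
        using elim r \<delta> by (auto simp: ennreal_le_iff ennreal_le_iff2)
      then have "1 - \<delta> \<le> r / q p" "r / q p \<le> 1 + \<delta>"
        using elim(3) by (auto simp: field_simps)
      then show ?case using r \<delta> by (simp add: dist_real_def abs_less_iff)
    qed
  qed
qed

theorem theorem5p5:
  fixes K l u :: nat
    and N :: "'a measure"
    and P0 P1 :: "nat \<Rightarrow> (nat \<Rightarrow> 'a) measure"
    and I J :: "nat \<Rightarrow> real"
    and a b c d :: "real \<times> real \<Rightarrow> real"
  assumes K: "K \<ge> 1"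
    and lu: "l \<le> u" "u \<le> K" "0 < u" "l < K"
    and laws: "\<And>k. k < K \<Longrightarrow> prob_space (P0 k) \<and> prob_space (P1 k)
                 \<and> sets (P0 k) = sets (seq_space N) \<and> sets (P1 k) = sets (seq_space N)"
    and mac: "\<And>k n. k < K \<Longrightarrow> absolutely_continuous (marg N (P0 k) n) (marg N (P1 k) n)
                 \<and> absolutely_continuous (marg N (P1 k) n) (marg N (P0 k) n)"
    and thr_pos: "\<And>\<alpha> \<beta>. 0 < \<alpha> \<Longrightarrow> \<alpha> < 1 \<Longrightarrow> 0 < \<beta> \<Longrightarrow> \<beta> < 1 \<Longrightarrow>
                 0 < a (\<alpha>, \<beta>) \<and> 0 < b (\<alpha>, \<beta>) \<and> 0 < c (\<alpha>, \<beta>) \<and> 0 < d (\<alpha>, \<beta>)"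
    and thr_Delta: "\<And>\<alpha> \<beta>. 0 < \<alpha> \<Longrightarrow> \<alpha> < 1 \<Longrightarrow> 0 < \<beta> \<Longrightarrow> \<beta> < 1 \<Longrightarrow>
        in_Delta K P0 P1 \<alpha> \<beta> (Pi_lu K l u)
          (\<lambda>\<omega>. check_T K l u (a (\<alpha>, \<beta>)) (b (\<alpha>, \<beta>)) (c (\<alpha>, \<beta>)) (d (\<alpha>, \<beta>)) (\<lambda>k n. jLLR N P0 P1 k n \<omega>))
          (\<lambda>k \<omega>. check_D K l u (a (\<alpha>, \<beta>)) (b (\<alpha>, \<beta>)) (c (\<alpha>, \<beta>)) (d (\<alpha>, \<beta>)) (\<lambda>k n. jLLR N P0 P1 k n \<omega>) k)"
    and a_asym: "((\<lambda>p. a p / \<bar>ln (fst p)\<bar>) \<longlongrightarrow> 1) (at_right 0 \<times>\<^sub>F at_right 0)"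
    and c_asym: "((\<lambda>p. c p / \<bar>ln (fst p)\<bar>) \<longlongrightarrow> 1) (at_right 0 \<times>\<^sub>F at_right 0)"
    and b_asym: "((\<lambda>p. b p / \<bar>ln (snd p)\<bar>) \<longlongrightarrow> 1) (at_right 0 \<times>\<^sub>F at_right 0)"
    and d_asym: "((\<lambda>p. d p / \<bar>ln (snd p)\<bar>) \<longlongrightarrow> 1) (at_right 0 \<times>\<^sub>F at_right 0)"
    and IJ_pos: "\<And>k. k < K \<Longrightarrow> 0 < I k \<and> 0 < J k"
    and limsup1: "\<And>k. k < K \<Longrightarrow>
        AE x in P1 k. limsup (\<lambda>n. ereal (LLR N (P0 k) (P1 k) n x / real n)) \<le> ereal (I k)"
    and limsup0: "\<And>k. k < K \<Longrightarrow>
        AE x in P0 k. limsup (\<lambda>n. ereal (- LLR N (P0 k) (P1 k) n x / real n)) \<le> ereal (J k)"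
    and compl1: "\<And>k \<epsilon>. k < K \<Longrightarrow> 0 < \<epsilon> \<Longrightarrow>
        summable (\<lambda>n. measure (P1 k) {x \<in> space (P1 k).
                    LLR N (P0 k) (P1 k) (Suc n) x / real (Suc n) \<le> I k - \<epsilon>})"
    and compl0: "\<And>k \<epsilon>. k < K \<Longrightarrow> 0 < \<epsilon> \<Longrightarrow>
        summable (\<lambda>n. measure (P0 k) {x \<in> space (P0 k).
                    - LLR N (P0 k) (P1 k) (Suc n) x / real (Suc n) \<le> J k - \<epsilon>})"
  shows "\<forall>A\<in>Pi_lu K l u.
     (\<forall>\<^sub>F p in at_right 0 \<times>\<^sub>F at_right 0.
        exp_time K P0 P1 A (\<lambda>\<omega>. check_T K l u (a p) (b p) (c p) (d p) (\<lambda>k n. jLLR N P0 P1 k n \<omega>)) < \<infinity>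
        \<and> L_sync K N P0 P1 (fst p) (snd p) (Pi_lu K l u) A < \<infinity>) \<and>
     ((\<lambda>p. enn2real (exp_time K P0 P1 A
              (\<lambda>\<omega>. check_T K l u (a p) (b p) (c p) (d p) (\<lambda>k n. jLLR N P0 P1 k n \<omega>)))
            / opt_rate K I J l u A (fst p) (snd p)) \<longlongrightarrow> 1) (at_right 0 \<times>\<^sub>F at_right 0) \<and>
     ((\<lambda>p. enn2real (L_sync K N P0 P1 (fst p) (snd p) (Pi_lu K l u) A)
            / opt_rate K I J l u A (fst p) (snd p)) \<longlongrightarrow> 1) (at_right 0 \<times>\<^sub>F at_right 0)"
proof
  fix A assume A: "A \<in> Pi_lu K l u"
  interpret sparse_detection K N P0 P1 I J l u A
    by unfold_locales (fact laws mac lu IJ_pos limsup1 limsup0 compl1 compl0 A)+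
  define F :: "(real \<times> real) filter" where "F = at_right 0 \<times>\<^sub>F at_right 0"
  define q where "q p = opt_rate K I J l u A (fst p) (snd p)" for p
  define T where "T p \<omega> = check_T K l u (a p) (b p) (c p) (d p) (\<lambda>k n. jLLR N P0 P1 k n \<omega>)" for p \<omega>
  define D where "D p k \<omega> = check_D K l u (a p) (b p) (c p) (d p) (\<lambda>k n. jLLR N P0 P1 k n \<omega>) k" for p k \<omega>
  define E where "E p = exp_time K P0 P1 A (T p)" for p
  define L where "L p = L_sync K N P0 P1 (fst p) (snd p) (Pi_lu K l u) A" for p
  have unit: "\<forall>\<^sub>F p in F. fst p \<in> {0<..<1} \<and> snd p \<in> {0<..<1}"
    unfolding F_def
    by (intro eventually_conj eventually_compose_filterlim[OF _ filterlim_fst]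
          eventually_compose_filterlim[OF _ filterlim_snd] eventually_at_right_real) auto
  have check: "procedure (fst p) (snd p) (T p) (D p)"
    if "fst p \<in> {0<..<1} \<and> snd p \<in> {0<..<1}" for p
    using that thr_Delta[of "fst p" "snd p"]
      sync_procedure_check[of l u "a p" "b p" "c p" "d p"]
    by (simp add: T_def[abs_def] D_def[abs_def])
  \<comment> \<open>The thresholds are assumed to control the errors, so the procedure is one of the
    competitors in the infimum.\<close>
  have L_le: "\<forall>\<^sub>F p in F. L p \<le> E p"
    using unit
  proof eventually_elim
    case (elim p)
    show ?case
      unfolding L_def L_sync_def
      using check[OF elim] by (intro INF_lower2[of "(T p, D p)"]) (auto simp: E_def)
  qed
  \<comment> \<open>The lower bound holds eventually for all procedures at once, so it passes to the
    infimum.\<close>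
  have lo_L: "\<forall>\<^sub>F p in F. ennreal ((1 - \<delta>) * q p) \<le> L p" if "0 < \<delta>" "\<delta> < 1" for \<delta>
    using exp_time_lower[OF that, folded F_def]
  proof eventually_elim
    case (elim p)
    then show ?case
      unfolding L_def L_sync_def q_def by (intro INF_greatest) auto
  qed
  have up_E: "\<forall>\<^sub>F p in F. E p \<le> ennreal ((1 + \<delta>) * q p)" if "0 < \<delta>" "\<delta> < 1" for \<delta>
    unfolding F_def E_def T_def q_def
  proof (rule exp_time_check_upper)
    show "\<forall>\<^sub>F p in at_right 0 \<times>\<^sub>F at_right 0. 0 < a p \<and> 0 < b p"
      using unit unfolding F_def
    proof eventually_elim
      case (elim p)
      then show ?case using thr_pos[of "fst p" "snd p"] by simp
    qed
  qed (fact a_asym b_asym c_asym d_asym that)+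
  \<comment> \<open>Because \<open>L\<close> is eventually at most \<open>E\<close>, the lower bound
    for \<open>L\<close> and the upper bound for \<open>E\<close> serve both quantities.\<close>
  have lo_E: "\<forall>\<^sub>F p in F. ennreal ((1 - \<delta>) * q p) \<le> E p" if "0 < \<delta>" "\<delta> < 1" for \<delta>
    using lo_L[OF that] L_le by eventually_elim (rule order_trans)
  have up_L: "\<forall>\<^sub>F p in F. L p \<le> ennreal ((1 + \<delta>) * q p)" if "0 < \<delta>" "\<delta> < 1" for \<delta>
    using up_E[OF that] L_le by eventually_elim (rule order_trans[rotated])
  have q: "filterlim q at_top F" using opt_rate_at_top by (simp add: q_def[abs_def] F_def)
  note ratio_tendsto_1[OF q lo_E up_E] ratio_tendsto_1[OF q lo_L up_L]
  then have "(\<forall>\<^sub>F p in F. E p < \<infinity> \<and> L p < \<infinity>) \<and>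
      ((\<lambda>p. enn2real (E p) / q p) \<longlongrightarrow> 1) F \<and> ((\<lambda>p. enn2real (L p) / q p) \<longlongrightarrow> 1) F"
    by (simp add: eventually_conj)
  then show "(\<forall>\<^sub>F p in at_right 0 \<times>\<^sub>F at_right 0.
        exp_time K P0 P1 A (\<lambda>\<omega>. check_T K l u (a p) (b p) (c p) (d p) (\<lambda>k n. jLLR N P0 P1 k n \<omega>)) < \<infinity>
        \<and> L_sync K N P0 P1 (fst p) (snd p) (Pi_lu K l u) A < \<infinity>) \<and>
     ((\<lambda>p. enn2real (exp_time K P0 P1 A
              (\<lambda>\<omega>. check_T K l u (a p) (b p) (c p) (d p) (\<lambda>k n. jLLR N P0 P1 k n \<omega>)))
            / opt_rate K I J l u A (fst p) (snd p)) \<longlongrightarrow> 1) (at_right 0 \<times>\<^sub>F at_right 0) \<and>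
     ((\<lambda>p. enn2real (L_sync K N P0 P1 (fst p) (snd p) (Pi_lu K l u) A)
            / opt_rate K I J l u A (fst p) (snd p)) \<longlongrightarrow> 1) (at_right 0 \<times>\<^sub>F at_right 0)"
    unfolding E_def T_def L_def q_def F_def .
qed

end
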